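(* Assume that $K$ is a p.c.f. self-similar set. Let $0<\alpha\le s$. Then, for any $f\in L^{\frac{\alpha}{s}}(K,H^\alpha_\mu)$ and $t>0$, $$H^\alpha_\mu(\{x\in K: M_{\mathcal{D}}^\mu f(x)>t\})\le 4\left(\frac{s}{\alpha}\right)^{\frac{\alpha}{s}}t^{-\frac{\alpha}{s}}\int_K |f(x)|^{\frac{\alpha}{s}}\,dH^\alpha_\mu.$$
   Context: Self-similar set and measure. For $1\le i\le m$ let $S_i:\mathbb{R}^d\to\mathbb{R}^d$, $S_i(x)=r_iR_i(x)+b_i$ with $0<r_i<1$, $b_i\in\mathbb{R}^d$, $R_i$ orthogonal. $K\subset\mathbb{R}^d$ is the unique nonempty compact set with $K=\bigcup_{i=1}^m S_i(K)$ (the self-similar set generated by $\{S_i\}_{i=1}^m$). It is always assumed that the $S_i$ do not all share a common fixed point. Given a probability vector $(p_1,\dots,p_m)$ with all $p_i>0$ and $\sum_i p_i=1$, $\mu$ is the unique Borel probability measure with $\mu=\sum_{i=1}^m p_i\,\mu\circ S_i^{-1}$ (self-similar measure; it is supported on $K$). $s$ denotes the Hausdorff dimension of $K$. Basic cubes. $\Sigma_n=\{1,\dots,m\}^n$ for $n\ge1$, $\Sigma_0=\{\emptyset\}$ (empty word). For $\mathbf{i}=i_1\ldots i_n$, $S_{\mathbf{i}}=S_{i_1}\circ\cdots\circ S_{i_n}$ and $K_{\mathbf{i}}=S_{\mathbf{i}}(K)$; $K_\emptyset=K$. $\mathcal{D}=\bigcup_{n\ge0}\{K_{\mathbf{i}}:\mathbf{i}\in\Sigma_n\}$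 is the collection of basic cubes. P.c.f. Let $\Sigma_\infty=\{1,\dots,m\}^{\mathbb{N}}$, let $\Pi:\Sigma_\infty\to K$ be the coding map, $\{\Pi(\mathbf{i})\}=\bigcap_{n\ge1}K_{i_1\ldots i_n}$, and let $\sigma$ be the shift $\sigma(i_1,i_2,\dots)=(i_2,i_3,\dots)$. Put $\mathcal{C}_K=\bigcup_{i\ne j}(S_i(K)\cap S_j(K))$ and $\mathcal{C}=\Pi^{-1}(\mathcal{C}_K)$. $K$ is post-critically finite (p.c.f.) if $\bigcup_{n\ge1}\sigma^n(\mathcal{C})$ is a finite set. Hausdorff content. For $E\subset K$ and $0<\alpha\le s$, $H^\alpha_\mu(E)=\inf\{\sum_j\mu(I_j)^{\alpha/s}: E\subset\bigcup_jI_j,\ I_j\in\mathcal{D}\}$, over countable (possibly finite) covers. Choquet integral. For $\mu$-measurable $f\ge0$ on $K$, $\int_K f\,dH^\alpha_\mu=\int_0^\infty H^\alpha_\mu(\{x\in K:f(x)>t\})\,dt$. For $0<p<\infty$, $\|f\|^p_{L^p(K,H^\alpha_\mu)}=\int_K|f|^p\,dH^\alpha_\mu=p\int_0^\infty t^{p-1}H^\alpha_\mu(\{x\in K:|f(x)|>t\})\,dt$, and $L^p(K,H^\alpha_\mu)$ is the space of $\mu$-measurable functions $f$ on $K$ for which this is finite. Maximal operator. $M_{\mathcal{D}}^\mu f(x)=\sup\frac{1}{\mu(K_{\mathbf{i}})}\int_{K_{\mathbf{i}}}|f|\,d\mu$ for $x\in K$, the supremum being over all $n\in\mathbb{N}=\{1,2,\dots\}$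 and all $\mathbf{i}\in\Sigma_n$ with $x\in K_{\mathbf{i}}$. *)

theory Defs
  imports "HOL-Probability.Probability"
begin

definition contracting_similarity :: "('a::euclidean_space \<Rightarrow> 'a) \<Rightarrow> bool" where
  "contracting_similarity f \<longleftrightarrow>
     (\<exists>r R b. 0 < r \<and> r < 1 \<and> orthogonal_transformation R \<and> f = (\<lambda>x. r *\<^sub>R R x + b))"

definition self_similar_set :: "nat \<Rightarrow> (nat \<Rightarrow> 'a::euclidean_space \<Rightarrow> 'a) \<Rightarrow> 'a set \<Rightarrow> bool" where
  "self_similar_set m S K \<longleftrightarrow> compact K \<and> K \<noteq> {} \<and> K = (\<Union>i\<in>{1..m}. S i ` K)"

definition probability_vector :: "nat \<Rightarrow> (nat \<Rightarrow> real) \<Rightarrow> bool" where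
  "probability_vector m p \<longleftrightarrow> (\<forall>i\<in>{1..m}. 0 < p i) \<and> (\<Sum>i=1..m. p i) = 1"

definition self_similar_measure ::
    "nat \<Rightarrow> (nat \<Rightarrow> 'a::euclidean_space \<Rightarrow> 'a) \<Rightarrow> (nat \<Rightarrow> real) \<Rightarrow> 'a measure \<Rightarrow> bool" where
  "self_similar_measure m S p \<mu> \<longleftrightarrow> prob_space \<mu> \<and> sets \<mu> = sets borel \<and>
     (\<forall>A\<in>sets borel. measure \<mu> A = (\<Sum>i=1..m. p i * measure \<mu> (S i -` A)))"

definition words :: "nat \<Rightarrow> nat \<Rightarrow> nat list set" where
  "words m n = {w. length w = n \<and> set w \<subseteq> {1..m}}"

definition word_map :: "(nat \<Rightarrow> 'a \<Rightarrow> 'a) \<Rightarrow> nat list \<Rightarrow> 'a \<Rightarrow> 'a" where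
  "word_map S w = foldr (\<lambda>i g. S i \<circ> g) w id"

definition cube :: "(nat \<Rightarrow> 'a \<Rightarrow> 'a) \<Rightarrow> 'a set \<Rightarrow> nat list \<Rightarrow> 'a set" where
  "cube S K w = word_map S w ` K"

definition basic_cubes :: "nat \<Rightarrow> (nat \<Rightarrow> 'a \<Rightarrow> 'a) \<Rightarrow> 'a set \<Rightarrow> 'a set set" where
  "basic_cubes m S K = (\<Union>n. cube S K ` words m n)"

text \<open>Infinite words are functions on the naturals, the first letter having index 0.\<close>

definition infinite_words :: "nat \<Rightarrow> (nat \<Rightarrow> nat) set" where
  "infinite_words m = UNIV \<rightarrow> {1..m}"

definition shift :: "(nat \<Rightarrow> nat) \<Rightarrow> nat \<Rightarrow> nat" where
  "shift \<omega> = (\<lambda>k. \<omega> (Suc k))"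

definition coding_map :: "(nat \<Rightarrow> 'a \<Rightarrow> 'a) \<Rightarrow> 'a set \<Rightarrow> (nat \<Rightarrow> nat) \<Rightarrow> 'a" where
  "coding_map S K \<omega> = (THE x. {x} = (\<Inter>n\<in>{1..}. cube S K (map \<omega> [0..<n])))"

definition overlap_set :: "nat \<Rightarrow> (nat \<Rightarrow> 'a \<Rightarrow> 'a) \<Rightarrow> 'a set \<Rightarrow> 'a set" where
  "overlap_set m S K = (\<Union>i\<in>{1..m}. \<Union>j\<in>{1..m} - {i}. S i ` K \<inter> S j ` K)"

definition critical_set :: "nat \<Rightarrow> (nat \<Rightarrow> 'a \<Rightarrow> 'a) \<Rightarrow> 'a set \<Rightarrow> (nat \<Rightarrow> nat) set" where
  "critical_set m S K = {\<omega>\<in>infinite_words m. coding_map S K \<omega> \<in> overlap_set m S K}"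

definition post_critically_finite :: "nat \<Rightarrow> (nat \<Rightarrow> 'a \<Rightarrow> 'a) \<Rightarrow> 'a set \<Rightarrow> bool" where
  "post_critically_finite m S K \<longleftrightarrow> finite (\<Union>n\<in>{1..}. (shift ^^ n) ` critical_set m S K)"

text \<open>The covering sets are required to be bounded because \<^const>\<open>diameter\<close> carries no
  information about unbounded sets.\<close>

definition hausdorff_outer_measure :: "real \<Rightarrow> 'a::metric_space set \<Rightarrow> ennreal" where
  "hausdorff_outer_measure t E =
     (SUP \<delta>\<in>{0<..}.
        INF A\<in>{A :: nat \<Rightarrow> 'a set. (\<forall>n. bounded (A n) \<and> diameter (A n) \<le> \<delta>) \<and> E \<subseteq> (\<Union>n. A n)}.
          \<Sum>n. ennreal (diameter (A n) powr t))"

text \<open>Only positive exponents are used: \<open>0 powr 0 = 0\<close> makes the exponent 0 differ from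
  counting measure, and leaving it out does not change the infimum.\<close>

definition hausdorff_dim :: "'a::metric_space set \<Rightarrow> ennreal" where
  "hausdorff_dim E = Inf {ennreal t | t. 0 < t \<and> hausdorff_outer_measure t E = 0}"

text \<open>Covers are families indexed by a set of natural numbers, hence countable and possibly
  finite or empty.\<close>

definition hausdorff_content ::
    "'a set set \<Rightarrow> 'a measure \<Rightarrow> real \<Rightarrow> real \<Rightarrow> 'a set \<Rightarrow> ennreal" where
  "hausdorff_content \<D> \<mu> s \<alpha> E =
     (INF (J, I)\<in>{(J :: nat set, I). (\<forall>j\<in>J. I j \<in> \<D>) \<and> E \<subseteq> (\<Union>j\<in>J. I j)}.
        \<Sum>\<^sub>\<infinity>j\<in>J. ennreal (measure \<mu> (I j) powr (\<alpha> / s)))"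

definition choquet_integral :: "('a set \<Rightarrow> ennreal) \<Rightarrow> 'a set \<Rightarrow> ('a \<Rightarrow> real) \<Rightarrow> ennreal" where
  "choquet_integral H K f = (\<integral>\<^sup>+t\<in>{0<..}. H {x\<in>K. f x > t} \<partial>lborel)"

text \<open>Measurability with respect to a Borel measure \<open>\<mu>\<close> refers to its completion; only the
  values of \<open>f\<close> on \<open>K\<close> matter.\<close>

definition choquet_Lp ::
    "'a measure \<Rightarrow> ('a set \<Rightarrow> ennreal) \<Rightarrow> 'a set \<Rightarrow> real \<Rightarrow> ('a \<Rightarrow> real) set" where
  "choquet_Lp \<mu> H K p =
     {f \<in> borel_measurable (restrict_space (completion \<mu>) K).
        choquet_integral H K (\<lambda>x. \<bar>f x\<bar> powr p) < \<infinity>}"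

definition dyadic_maximal ::
    "nat \<Rightarrow> (nat \<Rightarrow> 'a \<Rightarrow> 'a) \<Rightarrow> 'a set \<Rightarrow> 'a measure \<Rightarrow> ('a \<Rightarrow> real) \<Rightarrow> 'a \<Rightarrow> ennreal" where
  "dyadic_maximal m S K \<mu> f x =
     (SUP w\<in>{w. (\<exists>n\<ge>1. w \<in> words m n) \<and> x \<in> cube S K w}.
        (\<integral>\<^sup>+y\<in>cube S K w. ennreal \<bar>f y\<bar> \<partial>completion \<mu>) / emeasure \<mu> (cube S K w))"

end

theory Submission
  imports Defs "HOL-Library.Sublist"
begin

text \<open>
  Write \<open>\<beta> = \<alpha> / s \<le> 1\<close> and give the cube of a word \<open>w\<close> the weight \<open>c w = \<mu>(K_w) powr \<beta>\<close>; the Hausdorff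
  content \<open>H\<close> is then the least total weight of a cover by cubes. The set \<open>{M f > t}\<close> is covered by
  the maximal cubes on which the mean of \<open>\<bar>f\<bar>\<close> exceeds \<open>t\<close>; maximal means shortest words here, so they
  exist and form an antichain \<open>W\<close>. Three facts give the estimate.

  \<^item> On a single cube, \<open>\<integral> \<bar>f\<bar> d\<mu>\<close> is at most \<open>1 / \<beta> * I powr (1 / \<beta>)\<close>, where \<open>I\<close> is the Choquet integral
    of \<open>\<bar>f\<bar> powr \<beta>\<close> over the cube (\<open>nn_integral_le_content_integral_powr\<close>). Since the mean exceeds \<open>t\<close>, the
    weight of each cube in \<open>W\<close> is at most \<open>(1 / \<beta>) powr \<beta> * t powr (- \<beta>) * I\<close>.

  \<^item> These bounds cannot be summed over \<open>W\<close>, as \<open>H\<close> is in general not additive on disjoint cubes.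
    But \<open>W\<close> has a subfamily \<open>Z\<close> that is packed, that is, inside each cube \<open>Q\<close> the cubes of \<open>Z\<close> have
    at most twice the weight of \<open>Q\<close>, and whose total weight still bounds the content of the union
    of \<open>W\<close> (\<open>packed_subfamily\<close>).

  \<^item> Along a packed antichain, the sum of the contents \<open>H (E \<inter> Q)\<close> is at most \<open>3 * H E\<close>
    (\<open>sum_word_content_Int_le\<close>). Applied to the level sets of \<open>\<bar>f\<bar> powr \<beta>\<close> and integrated, this bounds
    the sum of the Choquet integrals over the cubes of \<open>Z\<close> by 3 times the full one.

  The last fact treats the basic cubes as if they were dyadic, either nested or disjoint. Cubes of
  incomparable words do overlap, but post-critical finiteness makes each overlap finite
  (\<open>finite_Int_parallel_cubes\<close>), and a countable set has content zero because \<open>\<mu>\<close> has no atoms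
  (\<open>self_similar_measure_singleton\<close>), which is where the absence of a common fixed point enters.
\<close>

section \<open>Hausdorff content of families indexed by words\<close>

text \<open>The Hausdorff content with weight \<open>c v\<close> for the set \<open>Q v\<close>, with covers given by sets of words
  instead of sequences of sets. A set of words may be thinned out, split and merged without
  reindexing, and several words may name the same set. \<open>A\<close> is the set of admissible words.\<close>

definition word_content ::
    "'l list set \<Rightarrow> ('l list \<Rightarrow> 'a set) \<Rightarrow> ('l list \<Rightarrow> real) \<Rightarrow> 'a set \<Rightarrow> ennreal" where
  "word_content A Q c E = (INF V\<in>{V. V \<subseteq> A \<and> E \<subseteq> (\<Union>v\<in>V. Q v)}. \<Sum>\<^sub>\<infinity>v\<in>V. ennreal (c v))"

lemma summable_on_into_ennreal [simp]:
  fixes f :: "'i \<Rightarrow> ennreal"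
  shows "f summable_on V"
  by (simp add: nonneg_summable_on_complete)

lemma infsum_ennreal_le:
  fixes b :: ennreal
  assumes "\<And>F. finite F \<Longrightarrow> F \<subseteq> V \<Longrightarrow> sum f F \<le> b"
  shows "infsum f V \<le> b"
  using assms by (intro infsum_le_finite_sums) auto

lemma infsum_ennreal_mono_set:
  fixes f :: "'i \<Rightarrow> ennreal"
  assumes "V \<subseteq> W"
  shows "infsum f V \<le> infsum f W"
  using assms by (intro infsum_mono_neutral) auto

lemma sum_le_infsum_ennreal:
  fixes f :: "'i \<Rightarrow> ennreal"
  assumes "finite F" "F \<subseteq> V"
  shows "sum f F \<le> infsum f V"
  using infsum_ennreal_mono_set[OF assms(2), of f] assms(1) by simp

lemma infsum_ennreal_Un_le:
  fixes f :: "'i \<Rightarrow> ennreal"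
  shows "infsum f (V \<union> W) \<le> infsum f V + infsum f W"
proof -
  have "infsum f (V \<union> (W - V)) = infsum f V + infsum f (W - V)"
    by (intro infsum_Un_disjoint) auto
  also have "\<dots> \<le> infsum f V + infsum f W"
    by (intro add_left_mono infsum_ennreal_mono_set) auto
  finally show ?thesis by simp
qed

lemma infsum_ennreal_image_le:
  fixes g :: "'j \<Rightarrow> ennreal"
  shows "infsum g (h ` J) \<le> (\<Sum>\<^sub>\<infinity>j\<in>J. g (h j))"
proof -
  obtain U where U: "U \<subseteq> J" "inj_on h U" "h ` J = h ` U"
    using subset_image_inj[of "h ` J" h J] by auto
  have "infsum g (h ` J) = (\<Sum>\<^sub>\<infinity>j\<in>U. g (h j))"
    using infsum_reindex[OF U(2), of g] U(3) by (simp add: o_def)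
  also have "\<dots> \<le> (\<Sum>\<^sub>\<infinity>j\<in>J. g (h j))"
    using U(1) by (rule infsum_ennreal_mono_set)
  finally show ?thesis .
qed

lemma word_content_le:
  assumes "V \<subseteq> A" "E \<subseteq> (\<Union>v\<in>V. Q v)"
  shows "word_content A Q c E \<le> (\<Sum>\<^sub>\<infinity>v\<in>V. ennreal (c v))"
  unfolding word_content_def using assms by (intro INF_lower) auto

lemma word_content_mono:
  assumes "E \<subseteq> E'"
  shows "word_content A Q c E \<le> word_content A Q c E'"
  unfolding word_content_def using assms by (intro INF_superset_mono) auto

lemma word_content_Un_le:
  "word_content A Q c (E \<union> E') \<le> word_content A Q c E + word_content A Q c E'"
proof (rule ennreal_le_epsilon)
  fix e :: real
  assume fin: "word_content A Q c E + word_content A Q c E' < top" and e: "0 < e"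
  have close: "\<exists>V\<subseteq>A. D \<subseteq> (\<Union>v\<in>V. Q v) \<and>
      (\<Sum>\<^sub>\<infinity>v\<in>V. ennreal (c v)) \<le> word_content A Q c D + ennreal (e / 2)"
    if "word_content A Q c D < top" for D
  proof -
    have "word_content A Q c D < word_content A Q c D + ennreal (e / 2)"
      using that e by (cases "word_content A Q c D") (auto simp flip: ennreal_plus simp: ennreal_lessI)
    then show ?thesis
      unfolding word_content_def INF_less_iff by (auto intro: less_imp_le)
  qed
  obtain V where V: "V \<subseteq> A" "E \<subseteq> (\<Union>v\<in>V. Q v)"
      "(\<Sum>\<^sub>\<infinity>v\<in>V. ennreal (c v)) \<le> word_content A Q c E + ennreal (e / 2)"
    using close[of E] fin by auto
  obtain V' where V': "V' \<subseteq> A" "E' \<subseteq> (\<Union>v\<in>V'. Q v)"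
      "(\<Sum>\<^sub>\<infinity>v\<in>V'. ennreal (c v)) \<le> word_content A Q c E' + ennreal (e / 2)"
    using close[of E'] fin by auto
  have "word_content A Q c (E \<union> E') \<le> (\<Sum>\<^sub>\<infinity>v\<in>V \<union> V'. ennreal (c v))"
    using V V' by (intro word_content_le) auto
  also have "\<dots> \<le> (\<Sum>\<^sub>\<infinity>v\<in>V. ennreal (c v)) + (\<Sum>\<^sub>\<infinity>v\<in>V'. ennreal (c v))"
    by (rule infsum_ennreal_Un_le)
  also have "\<dots> \<le> (word_content A Q c E + ennreal (e / 2)) + (word_content A Q c E' + ennreal (e / 2))"
    by (intro add_mono V V')
  also have "\<dots> = word_content A Q c E + word_content A Q c E' + (ennreal (e / 2) + ennreal (e / 2))"
    by (simp add: ac_simps)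
  also have "ennreal (e / 2) + ennreal (e / 2) = ennreal e"
    using e by (simp flip: ennreal_plus)
  finally show "word_content A Q c (E \<union> E') \<le> word_content A Q c E + word_content A Q c E' + ennreal e" .
qed

text \<open>A countable set costs nothing: its \<open>n\<close>-th point is covered at a cost of at most \<open>e / 2 ^ (n + 1)\<close>.
  This is what makes the overlaps of the cubes negligible.\<close>

lemma word_content_countable:
  fixes A :: "'l list set"
  assumes N: "countable N"
    and small: "\<And>x e. x \<in> N \<Longrightarrow> 0 < e \<Longrightarrow> \<exists>w\<in>A. x \<in> Q w \<and> c w < e"
  shows "word_content A Q c N = 0"
proof (cases "N = {}")
  case True
  then show ?thesis using word_content_le[of "{}" A N Q c] by simp
next
  case False
  have "word_content A Q c N \<le> 0 + ennreal e" if e: "0 < e" for e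
  proof -
    have "\<exists>w\<in>A. from_nat_into N n \<in> Q w \<and> c w < e * (1/2) ^ Suc n" for n
      using e by (intro small from_nat_into False) auto
    then obtain w where w: "\<And>n. w n \<in> A" "\<And>n. from_nat_into N n \<in> Q (w n)"
        "\<And>n. c (w n) < e * (1/2) ^ Suc n"
      by metis
    have "N \<subseteq> (\<Union>v\<in>range w. Q v)"
      using w(2) from_nat_into_surj[OF N] by fastforce
    then have "word_content A Q c N \<le> (\<Sum>\<^sub>\<infinity>v\<in>range w. ennreal (c v))"
      using w(1) by (intro word_content_le) auto
    also have "\<dots> \<le> (\<Sum>\<^sub>\<infinity>n. ennreal (c (w n)))"
      by (rule infsum_ennreal_image_le)
    also have "\<dots> \<le> ennreal e"
    proof (rule infsum_ennreal_le)
      fix F :: "nat set" assume F: "finite F"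
      have "(\<Sum>n\<in>F. ennreal (c (w n))) \<le> (\<Sum>n\<in>F. ennreal (e * (1/2) ^ Suc n))"
        using w(3) by (intro sum_mono ennreal_leI less_imp_le)
      also have "\<dots> = ennreal (e * (\<Sum>n\<in>F. (1/2) ^ Suc n))"
        using e by (subst sum_ennreal) (auto simp: sum_distrib_left)
      also have "(\<Sum>n\<in>F. (1/2::real) ^ Suc n) \<le> 1"
        using sum_le_suminf[OF sums_summable[OF power_half_series] F]
          sums_unique[OF power_half_series] by simp
      then have "ennreal (e * (\<Sum>n\<in>F. (1/2) ^ Suc n)) \<le> ennreal e"
        using e by (intro ennreal_leI) (simp add: mult_left_le)
      finally show "(\<Sum>n\<in>F. ennreal (c (w n))) \<le> ennreal e" .
    qed
    finally show ?thesis by simp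
  qed
  then have "word_content A Q c N \<le> 0" by (rule ennreal_le_epsilon)
  then show ?thesis by simp
qed

section \<open>Packed families of words\<close>

definition prefix_free :: "'l list set \<Rightarrow> bool" where
  "prefix_free V \<longleftrightarrow> (\<forall>v\<in>V. \<forall>w\<in>V. prefix v w \<longrightarrow> v = w)"

text \<open>Lengths of words are well-founded, so the shortest members of \<open>G\<close> along each branch always
  exist. They name the maximal cubes of the family \<open>G\<close>, without any bound on their size.\<close>

lemma minimal_words:
  obtains V where "V \<subseteq> G" "prefix_free V" "\<And>g. g \<in> G \<Longrightarrow> \<exists>v\<in>V. prefix v g"
proof
  let ?V = "{v\<in>G. \<forall>u\<in>G. prefix u v \<longrightarrow> u = v}"
  show "?V \<subseteq> G" "prefix_free ?V" by (auto simp: prefix_free_def)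
  fix g assume "g \<in> G"
  then show "\<exists>v\<in>?V. prefix v g"
  proof (induction g rule: measure_induct_rule[of length])
    case (less g)
    show ?case
    proof (cases "g \<in> ?V")
      case False
      then obtain u where u: "u \<in> G" "prefix u g" "u \<noteq> g" using less.prems by auto
      then have "length u < length g"
        by (intro prefix_length_less) (simp add: strict_prefix_def)
      with less.IH[OF this u(1)] u(2) show ?thesis by (meson prefix_order.trans)
    qed auto
  qed
qed

text \<open>A Carleson packing condition with constant 2: inside each cube, the chosen cubes weigh at most
  twice as much as the cube. It is imposed on finite subfamilies only, so that it passes to unions
  of chains and the sums stay real.\<close>

definition packed :: "'l list set \<Rightarrow> ('l list \<Rightarrow> real) \<Rightarrow> 'l list set \<Rightarrow> bool" where
  "packed A c Z \<longleftrightarrow> (\<forall>v\<in>A. \<forall>F. finite F \<and> F \<subseteq> {w\<in>Z. prefix v w} \<longrightarrow> sum c F \<le> 2 * c v)"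

text \<open>The selection of a packed subfamily whose weight still dominates the content of the union.
  Take \<open>Z\<close> maximal among the packed subfamilies of \<open>W\<close>, and call a word heavy if its weight is
  at most the total weight of the members of \<open>Z\<close> below it. If \<open>w\<close> is left out of \<open>Z\<close>, adding it
  violates the packing condition at some prefix \<open>v\<close> of \<open>w\<close>: the sum below \<open>v\<close> exceeds \<open>2 * c v\<close>.
  As \<open>c w \<le> c v\<close>, the sum without \<open>w\<close> still exceeds \<open>c v\<close>, and \<open>v\<close> is heavy. Members of \<open>Z\<close> are
  heavy themselves. So the minimal heavy words cover everything, and since no word of \<open>Z\<close> lies below
  two of them, their total weight is at most that of \<open>Z\<close>.\<close>

lemma packed_subfamily:
  fixes c :: "'l list \<Rightarrow> real"
  assumes WA: "W \<subseteq> A"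
    and A: "\<And>v w. w \<in> A \<Longrightarrow> prefix v w \<Longrightarrow> v \<in> A"
    and c0: "\<And>w. 0 \<le> c w"
    and c_mono: "\<And>v w. w \<in> A \<Longrightarrow> prefix v w \<Longrightarrow> c w \<le> c v"
    and Q_mono: "\<And>v w. w \<in> A \<Longrightarrow> prefix v w \<Longrightarrow> Q w \<subseteq> Q v"
  obtains Z where "Z \<subseteq> W" "packed A c Z"
    "word_content A Q c (\<Union>w\<in>W. Q w) \<le> (\<Sum>\<^sub>\<infinity>w\<in>Z. ennreal (c w))"
proof -
  let ?P = "{Z. Z \<subseteq> W \<and> packed A c Z}"
  have "\<exists>Z\<in>?P. \<forall>X\<in>?P. Z \<subseteq> X \<longrightarrow> X = Z"
  proof (rule subset_Zorn_nonempty)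
    have "{} \<in> ?P" using c0 by (auto simp: packed_def)
    then show "?P \<noteq> {}" by blast
    fix \<C> assume ne: "\<C> \<noteq> {}" and ch: "subset.chain ?P \<C>"
    have "packed A c (\<Union>\<C>)"
      unfolding packed_def
    proof (intro ballI allI impI, elim conjE)
      fix v F
      assume v: "v \<in> A" and F: "finite F" "F \<subseteq> {w\<in>\<Union>\<C>. prefix v w}"
      have "F \<subseteq> \<Union>\<C>" using F by auto
      then obtain B where B: "B \<in> \<C>" "F \<subseteq> B"
        using finite_subset_Union_chain[OF F(1) _ ne ch] by blast
      then have "packed A c B" using ch by (auto simp: subset.chain_def)
      then have "\<forall>F. finite F \<and> F \<subseteq> {w\<in>B. prefix v w} \<longrightarrow> sum c F \<le> 2 * c v"
        using v unfolding packed_def by blast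
      moreover have "F \<subseteq> {w\<in>B. prefix v w}" using F(2) B(2) by auto
      ultimately show "sum c F \<le> 2 * c v" using F(1) by blast
    qed
    moreover have "\<Union>\<C> \<subseteq> W" using ch by (auto simp: subset.chain_def)
    ultimately show "\<Union>\<C> \<in> ?P" by simp
  qed
  then obtain Z where ZP: "Z \<in> ?P" and Zmax: "\<forall>X\<in>?P. Z \<subseteq> X \<longrightarrow> X = Z"
    by (rule bexE)
  have Z: "Z \<subseteq> W" "packed A c Z" using ZP by simp_all
  have max: "X = Z" if "X \<subseteq> W" "packed A c X" "Z \<subseteq> X" for X
    using bspec[OF Zmax, of X] that by simp
  \<comment> \<open>the heavy words\<close>
  define G where
    "G = {v\<in>A. \<exists>F. finite F \<and> F \<subseteq> {w\<in>Z. prefix v w} \<and> c v \<le> sum c F}"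
  have heavy: "\<exists>v\<in>G. prefix v w" if w: "w \<in> W" for w
  proof (cases "w \<in> Z")
    case True
    then have "w \<in> G" using w WA unfolding G_def by (auto intro!: exI[of _ "{w}"])
    then show ?thesis by blast
  next
    case False
    then have "\<not> packed A c (insert w Z)" using max[of "insert w Z"] w Z(1) by auto
    then obtain v F where v: "v \<in> A" and F: "finite F" "F \<subseteq> {u\<in>insert w Z. prefix v u}"
      and gt: "2 * c v < sum c F"
      unfolding packed_def by (auto simp: not_le)
    have wF: "w \<in> F"
    proof (rule ccontr)
      assume "w \<notin> F"
      then have "F \<subseteq> {u\<in>Z. prefix v u}" using F by auto
      then show False using Z(2) v F(1) gt unfolding packed_def by fastforce
    qed
    then have vw: "prefix v w" using F by auto
    have "sum c F = c w + sum c (F - {w})" using F(1) wF by (simp add: sum.remove)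
    moreover have "c w \<le> c v" using c_mono w WA vw by auto
    ultimately have "c v \<le> sum c (F - {w})" using gt by simp
    then have "v \<in> G" using v F unfolding G_def by (auto intro!: exI[of _ "F - {w}"])
    then show ?thesis using vw by blast
  qed
  obtain V where V: "V \<subseteq> G" "prefix_free V" "\<And>g. g \<in> G \<Longrightarrow> \<exists>v\<in>V. prefix v g"
    using minimal_words by blast
  have "(\<Union>w\<in>W. Q w) \<subseteq> (\<Union>v\<in>V. Q v)"
  proof
    fix x assume "x \<in> (\<Union>w\<in>W. Q w)"
    then obtain w where w: "w \<in> W" "x \<in> Q w" by auto
    obtain v where "v \<in> V" "prefix v w"
      using heavy[OF w(1)] V(3) by (meson prefix_order.trans)
    then show "x \<in> (\<Union>v\<in>V. Q v)" using Q_mono[of w v] w WA by auto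
  qed
  moreover have "V \<subseteq> A" using V(1) by (auto simp: G_def)
  ultimately have "word_content A Q c (\<Union>w\<in>W. Q w) \<le> (\<Sum>\<^sub>\<infinity>v\<in>V. ennreal (c v))"
    by (intro word_content_le)
  also have "\<dots> \<le> (\<Sum>\<^sub>\<infinity>w\<in>Z. ennreal (c w))"
  proof (rule infsum_ennreal_le)
    fix F assume F: "finite F" "F \<subseteq> V"
    have "\<forall>v\<in>F. \<exists>D. finite D \<and> D \<subseteq> {w\<in>Z. prefix v w} \<and> c v \<le> sum c D"
      using F V(1) unfolding G_def by blast
    then obtain D where D: "\<And>v. v \<in> F \<Longrightarrow> finite (D v)"
        "\<And>v. v \<in> F \<Longrightarrow> D v \<subseteq> {w\<in>Z. prefix v w}" "\<And>v. v \<in> F \<Longrightarrow> c v \<le> sum c (D v)"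
      by metis
    \<comment> \<open>Two words with a common extension are comparable, so the sums below different minimal heavy
      words involve different members of \<open>Z\<close>.\<close>
    have disj: "D u \<inter> D v = {}" if uv: "u \<in> F" "v \<in> F" "u \<noteq> v" for u v
    proof (rule ccontr)
      assume "D u \<inter> D v \<noteq> {}"
      then obtain w where "prefix u w" "prefix v w" using D(2)[OF uv(1)] D(2)[OF uv(2)] by blast
      then have "prefix u v \<or> prefix v u" by (meson prefix_same_cases)
      then show False using V(2) F uv unfolding prefix_free_def by blast
    qed
    have "(\<Sum>v\<in>F. ennreal (c v)) = ennreal (sum c F)" using c0 by simp
    also have "sum c F \<le> (\<Sum>v\<in>F. sum c (D v))" using D(3) by (rule sum_mono)
    also have "(\<Sum>v\<in>F. sum c (D v)) = sum c (\<Union>v\<in>F. D v)"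
      using F D(1) disj by (intro sum.UNION_disjoint[symmetric]) auto
    also have "ennreal \<dots> = (\<Sum>w\<in>(\<Union>v\<in>F. D v). ennreal (c w))" using c0 by simp
    also have "\<dots> \<le> (\<Sum>\<^sub>\<infinity>w\<in>Z. ennreal (c w))"
      using F D by (intro sum_le_infsum_ennreal) auto
    finally show "(\<Sum>v\<in>F. ennreal (c v)) \<le> (\<Sum>\<^sub>\<infinity>w\<in>Z. ennreal (c w))"
      using ennreal_leI by blast
  qed
  finally show ?thesis using that Z by blast
qed

text \<open>The content is far from additive, but along a packed antichain \<open>Z\<close> it is superadditive up to a
  factor. Given a cover \<open>V\<close> of \<open>E\<close>, let \<open>k\<close> run through \<open>Z\<close>. If \<open>k\<close> lies below a member of \<open>V\<close>, cover
  \<open>E \<inter> Q k\<close> by \<open>Q k\<close>; by packing, these \<open>k\<close> cost at most \<open>2 * c v\<close> for each \<open>v\<close> in \<open>V\<close>. Otherwise cover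
  it by the members of \<open>V\<close> below \<open>k\<close>; each of them serves only one \<open>k\<close>, because \<open>Z\<close> is an antichain.
  The members of \<open>V\<close> incomparable to \<open>k\<close> meet \<open>Q k\<close> in a set of content zero.\<close>

lemma sum_word_content_Int_le:
  fixes c :: "'l list \<Rightarrow> real"
  assumes ZA: "Z \<subseteq> A" and Z: "packed A c Z" "prefix_free Z"
    and c0: "\<And>w. 0 \<le> c w"
    and negl: "\<And>k. k \<in> A \<Longrightarrow> word_content A Q c (\<Union>v\<in>{v\<in>A. v \<parallel> k}. Q v \<inter> Q k) = 0"
    and F: "finite F" "F \<subseteq> Z"
  shows "(\<Sum>k\<in>F. word_content A Q c (E \<inter> Q k)) \<le> 3 * word_content A Q c E"
proof -
  let ?H = "word_content A Q c" and ?C = "\<lambda>V. \<Sum>\<^sub>\<infinity>v\<in>V. ennreal (c v)"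
  have main: "(\<Sum>k\<in>F. ?H (E \<inter> Q k)) \<le> 3 * ?C V"
    if V: "V \<subseteq> A" "E \<subseteq> (\<Union>v\<in>V. Q v)" for V
  proof -
    define F1 where "F1 = {k\<in>F. \<exists>v\<in>V. prefix v k}"
    define below where "below k = {v\<in>V. prefix k v}" for k
    have "\<forall>k\<in>F1. \<exists>v\<in>V. prefix v k" by (auto simp: F1_def)
    then obtain p where p: "\<And>k. k \<in> F1 \<Longrightarrow> p k \<in> V" "\<And>k. k \<in> F1 \<Longrightarrow> prefix (p k) k" by metis
    have fin1: "finite F1" using F by (simp add: F1_def)
    have 1: "(\<Sum>k\<in>F1. ?H (E \<inter> Q k)) \<le> 2 * ?C V"
    proof -
      have "?H (E \<inter> Q k) \<le> ennreal (c k)" if "k \<in> F1" for k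
        using word_content_le[of "{k}" A "E \<inter> Q k" Q c] that F ZA by (auto simp: F1_def)
      then have "(\<Sum>k\<in>F1. ?H (E \<inter> Q k)) \<le> (\<Sum>k\<in>F1. ennreal (c k))" by (rule sum_mono)
      also have "\<dots> = ennreal (sum c F1)" using c0 by simp
      also have "sum c F1 = (\<Sum>v\<in>p ` F1. sum c {k\<in>F1. p k = v})"
        using fin1 by (rule sum.image_gen)
      also have "\<dots> \<le> (\<Sum>v\<in>p ` F1. 2 * c v)"
      proof (rule sum_mono)
        fix v assume "v \<in> p ` F1"
        then have "v \<in> A" using p(1) V(1) by auto
        moreover have "{k\<in>F1. p k = v} \<subseteq> {w\<in>Z. prefix v w}"
          using p(2) F(2) by (auto simp: F1_def)
        moreover have "finite {k\<in>F1. p k = v}" using fin1 by simp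
        ultimately show "sum c {k\<in>F1. p k = v} \<le> 2 * c v"
          using Z(1) unfolding packed_def by blast
      qed
      also have "ennreal (\<Sum>v\<in>p ` F1. 2 * c v) = 2 * (\<Sum>v\<in>p ` F1. ennreal (c v))"
        using c0 by (simp add: sum_distrib_left[symmetric] ennreal_mult sum_nonneg)
      also have "\<dots> \<le> 2 * ?C V"
        using fin1 p(1) by (intro mult_left_mono sum_le_infsum_ennreal) auto
      finally show ?thesis using ennreal_leI by blast
    qed
    have 2: "(\<Sum>k\<in>F - F1. ?H (E \<inter> Q k)) \<le> ?C V"
    proof -
      have "?H (E \<inter> Q k) \<le> ?C (below k)" if k: "k \<in> F - F1" for k
      proof -
        let ?N = "\<Union>v\<in>{v\<in>A. v \<parallel> k}. Q v \<inter> Q k"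
        have "E \<inter> Q k \<subseteq> (\<Union>v\<in>below k. Q v) \<union> ?N"
        proof
          fix x assume x: "x \<in> E \<inter> Q k"
          then obtain v where v: "v \<in> V" "x \<in> Q v" using V(2) by auto
          then have "\<not> prefix v k" using k by (auto simp: F1_def)
          then show "x \<in> (\<Union>v\<in>below k. Q v) \<union> ?N"
            using v x V(1) by (cases "prefix k v") (auto simp: below_def)
        qed
        then have "?H (E \<inter> Q k) \<le> ?H ((\<Union>v\<in>below k. Q v) \<union> ?N)" by (rule word_content_mono)
        also have "\<dots> \<le> ?H (\<Union>v\<in>below k. Q v) + ?H ?N" by (rule word_content_Un_le)
        also have "?H ?N = 0" using k F ZA by (intro negl) auto
        also have "?H (\<Union>v\<in>below k. Q v) \<le> ?C (below k)"
          using V(1) by (intro word_content_le) (auto simp: below_def)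
        finally show ?thesis by simp
      qed
      then have "(\<Sum>k\<in>F - F1. ?H (E \<inter> Q k)) \<le> (\<Sum>k\<in>F - F1. ?C (below k))" by (rule sum_mono)
      also have "\<dots> = ?C (\<Union>k\<in>F - F1. below k)"
      proof (rule sum_infsum)
        fix k l assume kl: "k \<in> F - F1" "l \<in> F - F1" "k \<noteq> l"
        show "below k \<inter> below l = {}"
        proof (rule ccontr)
          assume "below k \<inter> below l \<noteq> {}"
          then have "prefix k l \<or> prefix l k"
            unfolding below_def using prefix_same_cases by blast
          then show False using Z(2) F kl unfolding prefix_free_def by blast
        qed
      qed (use F in auto)
      also have "\<dots> \<le> ?C V" by (intro infsum_ennreal_mono_set) (auto simp: below_def)
      finally show ?thesis .
    qed
    have "(\<Sum>k\<in>F. ?H (E \<inter> Q k)) = (\<Sum>k\<in>F - F1. ?H (E \<inter> Q k)) + (\<Sum>k\<in>F1. ?H (E \<inter> Q k))"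
      using F by (intro sum.subset_diff) (auto simp: F1_def)
    also have "\<dots> \<le> ?C V + 2 * ?C V" by (intro add_mono 1 2)
    also have "\<dots> = (1 + 2) * ?C V" by (simp only: distrib_right mult_1)
    finally show ?thesis by simp
  qed
  show ?thesis
  proof (rule ennreal_le_epsilon)
    fix e :: real assume e: "0 < e" and fin: "3 * ?H E < top"
    then have "?H E < top" by (auto simp: ennreal_mult_less_top)
    then have "?H E < ?H E + ennreal (e / 3)"
      using e by (cases "?H E") (auto simp flip: ennreal_plus simp: ennreal_lessI)
    then obtain V where V: "V \<subseteq> A" "E \<subseteq> (\<Union>v\<in>V. Q v)" "?C V < ?H E + ennreal (e / 3)"
      unfolding word_content_def INF_less_iff by auto
    have "(\<Sum>k\<in>F. ?H (E \<inter> Q k)) \<le> 3 * ?C V" using V by (intro main)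
    also have "\<dots> \<le> 3 * (?H E + ennreal (e / 3))" using V(3) by (intro mult_left_mono) auto
    also have "\<dots> = 3 * ?H E + 3 * ennreal (e / 3)" by (rule distrib_left)
    also have "3 * ennreal (e / 3) = ennreal (3 * (e / 3))"
      using e by (subst ennreal_mult) auto
    also have "3 * (e / 3) = e" by simp
    finally show "(\<Sum>k\<in>F. ?H (E \<inter> Q k)) \<le> 3 * ?H E + ennreal e" .
  qed
qed

section \<open>Integrals and Choquet integrals\<close>

lemma borel_measurable_antimono_ennreal:
  fixes \<phi> :: "real \<Rightarrow> ennreal"
  assumes "antimono \<phi>"
  shows "\<phi> \<in> borel_measurable borel"
proof (rule borel_measurableI_greater)
  fix y
  define S where "S = {x. y < \<phi> x}"
  have "is_interval S"
    unfolding is_interval_1 S_def using antimonoD[OF assms] by (blast intro: less_le_trans)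
  then have "S \<in> sets borel"
    by (elim is_real_interval[THEN exE] exE disjE) simp_all
  then show "{x \<in> space borel. y < \<phi> x} \<in> sets borel"
    by (simp add: S_def)
qed

lemma nn_integral_powr_from_0:
  fixes q x :: real
  assumes "1 \<le> q" "0 \<le> x"
  shows "(\<integral>\<^sup>+u. ennreal (q * u powr (q - 1)) * indicator {u. 0 < u \<and> u < x} u \<partial>lborel) = ennreal (x powr q)"
proof -
  have "((\<lambda>u. u powr (q - 1)) has_integral (x powr (q - 1 + 1) / (q - 1 + 1))) {0..x}"
    using assms by (intro has_integral_powr_from_0) auto
  from has_integral_mult_right[OF this, of q]
  have "((\<lambda>u. q * u powr (q - 1)) has_integral x powr q) {0..x}"
    using assms by simp
  then have "(\<integral>\<^sup>+u. ennreal (indicator {0..x} u * (q * u powr (q - 1))) \<partial>lborel) = ennreal (x powr q)"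
    using assms by (intro nn_integral_has_integral_lebesgue) auto
  also have "(\<integral>\<^sup>+u. ennreal (indicator {0..x} u * (q * u powr (q - 1))) \<partial>lborel) =
      (\<integral>\<^sup>+u. ennreal (q * u powr (q - 1)) * indicator {u. 0 < u \<and> u < x} u \<partial>lborel)"
  proof (rule nn_integral_cong_AE)
    show "AE u in lborel. ennreal (indicator {0..x} u * (q * u powr (q - 1))) =
        ennreal (q * u powr (q - 1)) * indicator {u. 0 < u \<and> u < x} u"
      using AE_lborel_singleton[of 0] AE_lborel_singleton[of x]
    proof eventually_elim
      case (elim u)
      then show ?case using assms by (auto simp: indicator_def)
    qed
  qed
  finally show ?thesis .
qed

text \<open>With \<open>q = 1 / \<beta>\<close>, the layer cake formula for \<open>g = (g powr \<beta>) powr q\<close> reads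
  \<open>\<integral> g dM = \<integral> q * u powr (q - 1) * a u du\<close> where \<open>a u\<close> is the measure of \<open>{g powr \<beta> > u}\<close>. As the level
  sets decrease, \<open>u * a u powr \<beta>\<close> is at most the Choquet integral \<open>I\<close>. So
  \<open>u powr (q - 1) * a u = (u * a u powr \<beta>) powr (q - 1) * a u powr \<beta>\<close> is at most
  \<open>I powr (q - 1) * a u powr \<beta>\<close>, whose last factor is bounded by the content of the level set and
  integrates to at most \<open>I\<close>.\<close>

lemma nn_integral_le_content_integral_powr:
  fixes H :: "'a set \<Rightarrow> ennreal" and g :: "'a \<Rightarrow> real"
  assumes M: "finite_measure M" and \<beta>: "0 < \<beta>" "\<beta> \<le> 1"
    and g[measurable]: "g \<in> borel_measurable M" and g0: "\<And>x. 0 \<le> g x"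
    and H_mono: "\<And>E F. E \<subseteq> F \<Longrightarrow> H E \<le> H F"
    and H_ge: "\<And>u. 0 < u \<Longrightarrow> ennreal (measure M {x\<in>space M. u < g x powr \<beta>} powr \<beta>) \<le>
                 H {x\<in>space M. u < g x powr \<beta>}"
    and I: "(\<integral>\<^sup>+u\<in>{0<..}. H {x\<in>space M. u < g x powr \<beta>} \<partial>lborel) = ennreal I" and I0: "0 \<le> I"
  shows "(\<integral>\<^sup>+x. ennreal (g x) \<partial>M) \<le> ennreal (1 / \<beta> * I powr (1 / \<beta>))"
proof -
  interpret finite_measure M by fact
  interpret pair_sigma_finite M lborel ..
  define q where "q = 1 / \<beta>"
  have q: "1 \<le> q" "\<beta> * q = 1" using \<beta> by (auto simp: q_def)
  define E where "E u = {x\<in>space M. u < g x powr \<beta>}" for u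
  define a where "a u = measure M (E u)" for u
  have E[measurable]: "E u \<in> sets M" for u unfolding E_def by measurable
  have a0: "0 \<le> a u" for u by (simp add: a_def)
  have E_anti: "E u \<subseteq> E v" if "v \<le> u" for u v using that by (auto simp: E_def)
  have HE[measurable]: "(\<lambda>u. H (E u)) \<in> borel_measurable borel"
    using E_anti H_mono by (intro borel_measurable_antimono_ennreal) (auto simp: antimono_def)
  have I': "(\<integral>\<^sup>+u\<in>{0<..}. H (E u) \<partial>lborel) = ennreal I" using I by (simp add: E_def)
  have weak: "u * a u powr \<beta> \<le> I" if u: "0 < u" for u
  proof -
    have "ennreal (u * a u powr \<beta>) = (\<integral>\<^sup>+v. ennreal (a u powr \<beta>) * indicator {0<..u} v \<partial>lborel)"
      using u by (simp add: nn_integral_cmult_indicator ennreal_mult mult.commute)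
    also have "\<dots> \<le> (\<integral>\<^sup>+v\<in>{0<..}. H (E v) \<partial>lborel)"
    proof (rule nn_integral_mono)
      fix v
      show "ennreal (a u powr \<beta>) * indicator {0<..u} v \<le> H (E v) * indicator {0<..} v"
      proof (cases "v \<in> {0<..u}")
        case True
        have "ennreal (a u powr \<beta>) \<le> H (E u)" using H_ge[OF u] by (simp add: a_def E_def)
        also have "\<dots> \<le> H (E v)" using True by (intro H_mono E_anti) auto
        finally show ?thesis using True by simp
      qed simp
    qed
    finally show ?thesis using I' I0 by simp
  qed
  have tail: "u powr (q - 1) * a u \<le> I powr (q - 1) * a u powr \<beta>" if u: "0 < u" for u
  proof -
    have "a u = (a u powr \<beta>) powr (q - 1) * a u powr \<beta>"
      using a0[of u] q by (simp add: powr_powr powr_add[symmetric] algebra_simps)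
    then have "u powr (q - 1) * a u = (u * a u powr \<beta>) powr (q - 1) * a u powr \<beta>"
      using u by (simp add: powr_mult)
    also have "\<dots> \<le> I powr (q - 1) * a u powr \<beta>"
      using weak[OF u] u q by (intro mult_right_mono powr_mono2) auto
    finally show ?thesis .
  qed
  have "(\<integral>\<^sup>+x. ennreal (g x) \<partial>M) =
      (\<integral>\<^sup>+x. (\<integral>\<^sup>+u. ennreal (q * u powr (q - 1)) *
        indicator {u. 0 < u \<and> u < g x powr \<beta>} u \<partial>lborel) \<partial>M)"
    using nn_integral_powr_from_0[OF q(1)] g0 q(2) by (simp add: powr_powr)
  also have "\<dots> = (\<integral>\<^sup>+u. (\<integral>\<^sup>+x. ennreal (q * u powr (q - 1)) *
        indicator {u. 0 < u \<and> u < g x powr \<beta>} u \<partial>M) \<partial>lborel)"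
    by (rule Fubini'[symmetric]) measurable
  also have "\<dots> \<le> (\<integral>\<^sup>+u. ennreal (q * I powr (q - 1)) * (H (E u) * indicator {0<..} u) \<partial>lborel)"
  proof (rule nn_integral_mono)
    fix u :: real
    show "(\<integral>\<^sup>+x. ennreal (q * u powr (q - 1)) * indicator {u. 0 < u \<and> u < g x powr \<beta>} u \<partial>M)
        \<le> ennreal (q * I powr (q - 1)) * (H (E u) * indicator {0<..} u)"
    proof (cases "0 < u")
      case u: True
      have "(\<integral>\<^sup>+x. ennreal (q * u powr (q - 1)) * indicator {u. 0 < u \<and> u < g x powr \<beta>} u \<partial>M)
          = (\<integral>\<^sup>+x. ennreal (q * u powr (q - 1)) * indicator (E u) x \<partial>M)"
        using u by (intro nn_integral_cong) (auto simp: E_def indicator_def)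
      also have "\<dots> = ennreal (q * u powr (q - 1)) * emeasure M (E u)"
        by (simp add: nn_integral_cmult_indicator)
      also have "\<dots> = ennreal (q * (u powr (q - 1) * a u))"
        using q by (simp add: emeasure_eq_measure a_def ennreal_mult mult.assoc)
      also have "\<dots> \<le> ennreal (q * (I powr (q - 1) * a u powr \<beta>))"
        using tail[OF u] q by (intro ennreal_leI mult_left_mono) auto
      also have "\<dots> = ennreal (q * I powr (q - 1)) * ennreal (a u powr \<beta>)"
        using q by (simp add: ennreal_mult mult.assoc)
      also have "\<dots> \<le> ennreal (q * I powr (q - 1)) * H (E u)"
        using H_ge[OF u] by (intro mult_left_mono) (auto simp: a_def E_def)
      finally show ?thesis using u by simp
    qed simp
  qed
  also have "\<dots> = ennreal (q * I powr (q - 1)) * ennreal I"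
    by (simp add: nn_integral_cmult I')
  also have "\<dots> = ennreal (q * (I powr (q - 1) * I))"
    using q I0 by (simp add: ennreal_mult mult.assoc)
  also have "I powr (q - 1) * I = I powr q"
    using I0 by (simp add: powr_mult_base[symmetric] mult.commute powr_diff)
  finally show ?thesis by (simp add: q_def)
qed

text \<open>For \<open>\<beta> \<le> 1\<close> the power \<open>\<beta>\<close> of a sum is at most the sum of the powers: if \<open>T\<close> is the sum of the
  \<open>c v = measure M (Q v) powr \<beta>\<close>, then \<open>c v \<le> T\<close> and
  \<open>measure M (Q v) = c v * c v powr (1 / \<beta> - 1) \<le> c v * T powr (1 / \<beta> - 1)\<close>; sum over \<open>v\<close>.\<close>

lemma measure_powr_le_word_content:
  fixes Q :: "'l::countable list \<Rightarrow> 'a set"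
  assumes M: "finite_measure M" and \<beta>: "0 < \<beta>" "\<beta> \<le> 1"
    and Q: "\<And>v. v \<in> A \<Longrightarrow> Q v \<in> sets M"
  shows "ennreal (measure M E powr \<beta>) \<le> word_content A Q (\<lambda>v. measure M (Q v) powr \<beta>) E"
  unfolding word_content_def
proof (rule INF_greatest)
  interpret finite_measure M by fact
  fix V assume "V \<in> {V. V \<subseteq> A \<and> E \<subseteq> (\<Union>v\<in>V. Q v)}"
  then have V: "V \<subseteq> A" "E \<subseteq> (\<Union>v\<in>V. Q v)" by auto
  define c where "c v = measure M (Q v) powr \<beta>" for v
  define q where "q = 1 / \<beta>"
  have q: "1 \<le> q" "\<beta> * q = 1" using \<beta> by (auto simp: q_def)
  show "ennreal (measure M E powr \<beta>) \<le> (\<Sum>\<^sub>\<infinity>v\<in>V. ennreal (measure M (Q v) powr \<beta>))"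
  proof (cases "\<Sum>\<^sub>\<infinity>v\<in>V. ennreal (c v)")
    case top
    then show ?thesis by (simp add: c_def)
  next
    case (real T)
    have meas_le: "measure M (Q v) \<le> c v * T powr (q - 1)" if v: "v \<in> V" for v
    proof -
      have "ennreal (c v) \<le> ennreal T"
        using sum_le_infsum_ennreal[of "{v}" V "\<lambda>v. ennreal (c v)"] v real by simp
      then have "c v \<le> T" using real by simp
      have "measure M (Q v) = c v * c v powr (q - 1)"
        using q by (simp add: c_def powr_powr powr_add[symmetric] algebra_simps)
      also have "\<dots> \<le> c v * T powr (q - 1)"
        using \<open>c v \<le> T\<close> q by (intro mult_left_mono powr_mono2) (auto simp: c_def)
      finally show ?thesis .
    qed
    define B where "B n = (if n \<in> to_nat ` V then Q (from_nat n) else {})" for n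
    have B: "range B \<subseteq> sets M" using Q V(1) by (auto simp: B_def)
    have "E \<subseteq> (\<Union>n. B n)"
    proof
      fix x assume "x \<in> E"
      then obtain v where "v \<in> V" "x \<in> Q v" using V(2) by auto
      then have "x \<in> B (to_nat v)" by (simp add: B_def)
      then show "x \<in> (\<Union>n. B n)" by blast
    qed
    then have "emeasure M E \<le> emeasure M (\<Union>n. B n)" using B by (intro emeasure_mono) auto
    also have "\<dots> \<le> (\<Sum>n. emeasure M (B n))" by (rule emeasure_subadditive_countably[OF B])
    also have "\<dots> = (SUP N. \<Sum>n<N. emeasure M (B n))" by (rule suminf_eq_SUP)
    also have "\<dots> \<le> ennreal (T * T powr (q - 1))"
    proof (rule SUP_least)
      fix N :: nat
      define F where "F = {v\<in>V. to_nat v < N}"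
      have finF: "finite F"
        by (rule finite_imageD[OF finite_subset[of _ "{..<N}"]]) (auto simp: F_def inj_on_def)
      have "(\<Sum>n<N. emeasure M (B n)) = (\<Sum>n\<in>to_nat ` F. emeasure M (B n))"
        by (rule sum.mono_neutral_right) (auto simp: F_def B_def)
      also have "\<dots> = (\<Sum>v\<in>F. emeasure M (B (to_nat v)))"
        by (subst sum.reindex) (auto simp: inj_on_def)
      also have "\<dots> = (\<Sum>v\<in>F. ennreal (measure M (Q v)))"
        by (intro sum.cong) (auto simp: F_def B_def emeasure_eq_measure)
      also have "\<dots> \<le> (\<Sum>v\<in>F. ennreal (c v) * ennreal (T powr (q - 1)))"
        using meas_le by (intro sum_mono) (auto simp: F_def c_def ennreal_mult[symmetric] intro!: ennreal_leI)
      also have "\<dots> = (\<Sum>v\<in>F. ennreal (c v)) * ennreal (T powr (q - 1))"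
        by (rule sum_distrib_right[symmetric])
      also have "(\<Sum>v\<in>F. ennreal (c v)) \<le> ennreal T"
        unfolding real(2)[symmetric] using finF by (intro sum_le_infsum_ennreal) (auto simp: F_def)
      then have "(\<Sum>v\<in>F. ennreal (c v)) * ennreal (T powr (q - 1)) \<le> ennreal T * ennreal (T powr (q - 1))"
        by (intro mult_right_mono) auto
      also have "\<dots> = ennreal (T * T powr (q - 1))" using real(1) by (simp add: ennreal_mult)
      finally show "(\<Sum>n<N. emeasure M (B n)) \<le> ennreal (T * T powr (q - 1))" .
    qed
    also have "T * T powr (q - 1) = T powr q"
      using real(1) by (simp add: powr_mult_base)
    finally have "measure M E \<le> T powr q" by (simp add: emeasure_eq_measure)
    then have "measure M E powr \<beta> \<le> (T powr q) powr \<beta>" using \<beta> by (intro powr_mono2) auto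
    also have "\<dots> = T" using q real(1) by (simp add: powr_powr mult.commute)
    finally have "ennreal (measure M E powr \<beta>) \<le> ennreal T" by (rule ennreal_leI)
    then show ?thesis using real(2) by (simp add: c_def)
  qed
qed

section \<open>Self-similar measures without atoms\<close>

lemma contracting_similarity_dist:
  assumes "contracting_similarity f"
  obtains r where "0 < r" "r < 1" "\<And>x y. dist (f x) (f y) = r * dist x y"
proof -
  obtain r R b where r: "0 < r" "r < 1" "orthogonal_transformation R" "f = (\<lambda>x. r *\<^sub>R R x + b)"
    using assms unfolding contracting_similarity_def by blast
  have "dist (f x) (f y) = r * dist x y" for x y
  proof -
    have "f x - f y = r *\<^sub>R R (x - y)"
      using r(3) by (simp add: r(4) orthogonal_transformation_def linear_diff scaleR_diff_right)
    then show ?thesis using r by (simp add: dist_norm orthogonal_transformation_norm)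
  qed
  then show ?thesis using that r by blast
qed

lemma contracting_similarity_bij:
  assumes "contracting_similarity f"
  shows "bij f"
proof -
  obtain r R b where r: "0 < r" "orthogonal_transformation R" "f = (\<lambda>x. r *\<^sub>R R x + b)"
    using assms unfolding contracting_similarity_def by blast
  have R: "bij R" using r(2) by (rule orthogonal_transformation_bij)
  have "f = (\<lambda>y. r *\<^sub>R y + b) \<circ> R" using r(3) by (simp add: fun_eq_iff)
  moreover have "bij (\<lambda>y. r *\<^sub>R y + b)"
  proof (rule bij_betw_byWitness[where f' = "\<lambda>z. (1 / r) *\<^sub>R (z - b)"])
  qed (use r(1) in auto)
  ultimately show ?thesis using R bij_comp by metis
qed

lemma uniform_contraction:
  assumes "\<forall>i\<in>{1..m}. contracting_similarity (S i)"
  obtains \<rho> where "0 \<le> \<rho>" "\<rho> < 1"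
    "\<And>i x y. i \<in> {1..m::nat} \<Longrightarrow> dist (S i x) (S i y) \<le> \<rho> * dist x y"
proof -
  have "\<forall>i\<in>{1..m}. \<exists>r. 0 < r \<and> r < 1 \<and> (\<forall>x y. dist (S i x) (S i y) = r * dist x y)"
    using assms contracting_similarity_dist by metis
  then obtain r where r: "\<And>i. i \<in> {1..m} \<Longrightarrow> 0 < r i" "\<And>i. i \<in> {1..m} \<Longrightarrow> r i < 1"
      "\<And>i x y. i \<in> {1..m} \<Longrightarrow> dist (S i x) (S i y) = r i * dist x y"
    by metis
  define \<rho> where "\<rho> = Max (insert 0 (r ` {1..m}))"
  have "0 \<le> \<rho>" unfolding \<rho>_def by (intro Max_ge) auto
  moreover have "\<rho> < 1" unfolding \<rho>_def using r(2) by (subst Max_less_iff) auto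
  moreover have "dist (S i x) (S i y) \<le> \<rho> * dist x y" if i: "i \<in> {1..m}" for i x y
  proof -
    have "r i \<le> \<rho>" unfolding \<rho>_def using i by (intro Max_ge) auto
    then show ?thesis using r(3)[OF i] by (simp add: mult_right_mono)
  qed
  ultimately show ?thesis using that by blast
qed

lemma finite_atoms:
  assumes "finite_measure M" "\<And>x. {x} \<in> sets M" "0 < a"
  shows "finite {x. a \<le> measure M {x}}"
proof (rule ccontr)
  interpret finite_measure M by fact
  assume "infinite {x. a \<le> measure M {x}}"
  moreover obtain n :: nat where n: "measure M (space M) < n * a"
    using ex_less_of_nat_mult[OF assms(3)] by blast
  ultimately obtain T where T: "finite T" "card T = n" "T \<subseteq> {x. a \<le> measure M {x}}"
    using infinite_arbitrarily_large by metis
  have "n * a = (\<Sum>x\<in>T. a)" using T by simp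
  also have "\<dots> \<le> (\<Sum>x\<in>T. measure M {x})" using T by (intro sum_mono) auto
  also have "\<dots> = measure M T"
    using T assms(2) by (intro measure_eq_sum_singleton[symmetric]) auto
  also have "\<dots> \<le> measure M (space M)" by (rule bounded_measure)
  finally show False using n by simp
qed

text \<open>If there were an atom, there would be a largest atomic mass \<open>a\<close>, carried by the
  points of a finite set \<open>F\<close>. The mass of a point is a weighted mean of the masses of its preimages, so
  the preimages under every \<open>S i\<close> of a point of \<open>F\<close> are again in \<open>F\<close>. Preimages under a contraction
  are further apart than their images, hence two points of \<open>F\<close> at maximal distance must coincide,
  and the only point of \<open>F\<close> is fixed by all \<open>S i\<close>.\<close>

lemma self_similar_measure_singleton:
  assumes S: "\<forall>i\<in>{1..m}. contracting_similarity (S i)"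
    and nfix: "\<not> (\<exists>x. \<forall>i\<in>{1..m}. S i x = x)"
    and p: "probability_vector m p"
    and \<mu>: "self_similar_measure m S p \<mu>"
  shows "measure \<mu> {x} = 0"
proof (rule ccontr)
  interpret prob_space \<mu> using \<mu> by (simp add: self_similar_measure_def)
  have sets: "sets \<mu> = sets borel" using \<mu> by (simp add: self_similar_measure_def)
  assume "measure \<mu> {x} \<noteq> 0"
  then have pos: "0 < measure \<mu> {x}" by (simp add: zero_less_measure_iff)
  let ?B = "{y. measure \<mu> {x} \<le> measure \<mu> {y}}"
  have finB: "finite ?B"
    by (rule finite_atoms) (use pos sets in \<open>auto intro: finite_measure_axioms\<close>)
  define a where "a = Max ((\<lambda>y. measure \<mu> {y}) ` ?B)"
  have a_ge: "measure \<mu> {y} \<le> a" for y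
  proof (cases "y \<in> ?B")
    case True
    then show ?thesis unfolding a_def using finB by (intro Max_ge) auto
  next
    case False
    have "measure \<mu> {x} \<le> a" unfolding a_def using finB by (intro Max_ge) auto
    then show ?thesis using False by simp
  qed
  have "a \<in> (\<lambda>y. measure \<mu> {y}) ` ?B" unfolding a_def using finB by (intro Max_in) auto
  then obtain z0 where z0: "measure \<mu> {z0} = a" by blast
  have a_pos: "0 < a" using pos a_ge[of x] by simp
  define F where "F = {y. measure \<mu> {y} = a}"
  have finF: "finite F"
    by (rule finite_subset[OF _ finite_atoms[OF _ _ a_pos, of \<mu>]])
      (use sets in \<open>auto simp: F_def intro: finite_measure_axioms\<close>)
  have preimage: "\<exists>y\<in>F. S i y = z" if i: "i \<in> {1..m}" and z: "z \<in> F" for i z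
  proof -
    have "bij (S j)" if "j \<in> {1..m}" for j using S that contracting_similarity_bij by blast
    then have "\<exists>y. S j -` {z} = {y}" if "j \<in> {1..m}" for j
      using that by (metis bij_vimage_eq_inv_image image_empty image_insert)
    then obtain y where y: "\<And>j. j \<in> {1..m} \<Longrightarrow> S j -` {z} = {y j}" by metis
    have "(\<Sum>j=1..m. p j * a) = a"
      using p by (simp add: probability_vector_def sum_distrib_right[symmetric])
    also have "\<dots> = (\<Sum>j=1..m. p j * measure \<mu> (S j -` {z}))"
      using \<mu> z by (simp add: self_similar_measure_def F_def)
    also have "\<dots> = (\<Sum>j=1..m. p j * measure \<mu> {y j})" using y by simp
    finally have "(\<Sum>j=1..m. p j * (a - measure \<mu> {y j})) = 0"
      by (simp add: right_diff_distrib sum_subtractf)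
    moreover have "0 \<le> p j * (a - measure \<mu> {y j})" if "j \<in> {1..m}" for j
      using p that a_ge by (simp add: probability_vector_def less_imp_le)
    ultimately have "p i * (a - measure \<mu> {y i}) = 0"
      using i sum_nonneg_eq_0_iff[of "{1..m}" "\<lambda>j. p j * (a - measure \<mu> {y j})"] by blast
    moreover have "0 < p i" using p i by (simp add: probability_vector_def)
    ultimately have "y i \<in> F" by (simp add: F_def)
    moreover have "S i (y i) = z" using y[OF i] by auto
    ultimately show ?thesis by blast
  qed
  obtain \<rho> where \<rho>: "\<rho> < 1" "\<And>i x y. i \<in> {1..m} \<Longrightarrow> dist (S i x) (S i y) \<le> \<rho> * dist x y" "0 \<le> \<rho>"
    using uniform_contraction[OF S] by metis
  have "(\<Sum>i=1..m. p i) \<noteq> 0" using p by (simp add: probability_vector_def)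
  then have m: "1 \<in> {1..m}" by (cases m) auto
  let ?D = "(\<lambda>(u, v). dist u v) ` (F \<times> F)"
  have F0: "z0 \<in> F" using z0 by (simp add: F_def)
  have "Max ?D \<in> ?D" using finF F0 by (intro Max_in) auto
  then obtain u v where uv: "u \<in> F" "v \<in> F" "dist u v = Max ?D" by auto
  have le_uv: "dist y z \<le> dist u v" if "y \<in> F" "z \<in> F" for y z
    unfolding uv(3) using finF that by (intro Max_ge) force+
  obtain u' v' where u'v': "u' \<in> F" "S 1 u' = u" "v' \<in> F" "S 1 v' = v"
    using preimage[OF m] uv by metis
  have "dist u v \<le> \<rho> * dist u' v'" using \<rho>(2)[OF m, of u' v'] u'v' by simp
  also have "\<dots> \<le> \<rho> * dist u v" using le_uv u'v' \<rho>(3) by (intro mult_left_mono) auto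
  finally have "(1 - \<rho>) * dist u v \<le> 0" by (simp add: algebra_simps)
  then have "dist u v = 0" using \<rho>(1) by (simp add: mult_le_0_iff)
  then have "y = z0" if "y \<in> F" for y using le_uv[OF that F0] by simp
  then have "S i z0 = z0" if "i \<in> {1..m}" for i using preimage[OF that F0] by metis
  then show False using nfix by blast
qed

section \<open>Basic cubes of post-critically finite sets\<close>

definition finite_words :: "nat \<Rightarrow> nat list set" where
  "finite_words m = {w. set w \<subseteq> {1..m}}"

lemma word_map_Nil [simp]: "word_map S [] = id"
  and word_map_Cons [simp]: "word_map S (i # w) = S i \<circ> word_map S w"
  by (simp_all add: word_map_def)

lemma word_map_append: "word_map S (v @ w) = word_map S v \<circ> word_map S w"
  by (induction v) (simp_all add: comp_assoc)

lemma cube_append: "cube S K (v @ w) = word_map S v ` cube S K w"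
  by (simp add: cube_def word_map_append image_comp)

context
  fixes m :: nat and S :: "nat \<Rightarrow> 'a::euclidean_space \<Rightarrow> 'a" and K :: "'a set"
  assumes sim: "\<forall>i\<in>{1..m}. contracting_similarity (S i)"
    and ssK: "self_similar_set m S K"
begin

lemma self_similar_invariant: "K = (\<Union>i\<in>{1..m}. S i ` K)"
  using ssK by (simp add: self_similar_set_def)

lemma cube_subset_K: "w \<in> finite_words m \<Longrightarrow> cube S K w \<subseteq> K"
proof (induction w)
  case (Cons i w)
  then have "cube S K w \<subseteq> K" and i: "i \<in> {1..m}" by (auto simp: finite_words_def)
  then have "cube S K (i # w) \<subseteq> S i ` K" using cube_append[of S K "[i]" w] by auto
  also have "\<dots> \<subseteq> K" using self_similar_invariant i by blast
  finally show ?case .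
qed (simp add: cube_def)

lemma cube_mono:
  assumes "w \<in> finite_words m" "prefix v w"
  shows "cube S K w \<subseteq> cube S K v"
proof -
  obtain u where u: "w = v @ u" using assms(2) by (auto simp: prefix_def)
  then have "cube S K u \<subseteq> K" using assms(1) by (intro cube_subset_K) (auto simp: finite_words_def)
  then show ?thesis unfolding u cube_append by (auto simp: cube_def)
qed

lemma continuous_on_word_map: "w \<in> finite_words m \<Longrightarrow> continuous_on X (word_map S w)"
proof (induction w)
  case Nil
  then show ?case by (simp add: continuous_on_id)
next
  case (Cons i w)
  then have w: "continuous_on X (word_map S w)" and i: "i \<in> {1..m}"
    by (auto simp: finite_words_def)
  obtain r where "0 < r" "\<And>x y. dist (S i x) (S i y) = r * dist x y"
    using sim i contracting_similarity_dist by metis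
  then have "r-lipschitz_on (word_map S w ` X) (S i)" by (intro lipschitz_onI) auto
  then have "continuous_on (word_map S w ` X) (S i)" by (rule lipschitz_on_continuous_on)
  then show ?case unfolding word_map_Cons using w by (intro continuous_on_compose)
qed

lemma compact_cube:
  assumes "w \<in> finite_words m"
  shows "compact (cube S K w)"
proof -
  have "compact K" using ssK by (simp add: self_similar_set_def)
  then show ?thesis
    unfolding cube_def by (intro compact_continuous_image continuous_on_word_map assms)
qed

lemma in_cube_of_length:
  assumes "x \<in> K"
  shows "\<exists>w\<in>words m n. x \<in> cube S K w"
  using assms
proof (induction n arbitrary: x)
  case 0
  then show ?case by (auto simp: words_def cube_def)
next
  case (Suc n)
  obtain i y where i: "i \<in> {1..m}" "y \<in> K" "x = S i y"
    using Suc.prems self_similar_invariant by blast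
  obtain w where w: "w \<in> words m n" "y \<in> cube S K w" using Suc.IH[OF i(2)] by blast
  have "x \<in> cube S K (i # w)" using w(2) i(3) by (auto simp: cube_def)
  moreover have "i # w \<in> words m (Suc n)" using w(1) i(1) by (auto simp: words_def)
  ultimately show ?case by blast
qed

lemma small_cubes:
  assumes e: "0 < e"
  obtains n where "\<And>w x y. w \<in> finite_words m \<Longrightarrow> n \<le> length w \<Longrightarrow>
    x \<in> cube S K w \<Longrightarrow> y \<in> cube S K w \<Longrightarrow> dist x y < e"
proof -
  obtain \<rho> where \<rho>: "0 \<le> \<rho>" "\<rho> < 1"
      "\<And>i x y. i \<in> {1..m} \<Longrightarrow> dist (S i x) (S i y) \<le> \<rho> * dist x y"
    using uniform_contraction[OF sim] by metis
  have word: "dist (word_map S w x) (word_map S w y) \<le> \<rho> ^ length w * dist x y"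
    if "w \<in> finite_words m" for w x y
    using that
  proof (induction w)
    case (Cons i w)
    then have "dist (word_map S (i # w) x) (word_map S (i # w) y)
        \<le> \<rho> * dist (word_map S w x) (word_map S w y)"
      using \<rho>(3)[of i] by (simp add: finite_words_def)
    also have "\<dots> \<le> \<rho> * (\<rho> ^ length w * dist x y)"
      using Cons \<rho>(1) by (intro mult_left_mono) (auto simp: finite_words_def)
    finally show ?case by (simp add: mult.assoc)
  qed simp
  have bK: "bounded K" using ssK by (simp add: self_similar_set_def compact_imp_bounded)
  have "(\<lambda>n. \<rho> ^ n * diameter K) \<longlonglongrightarrow> 0 * diameter K"
    using \<rho> by (intro tendsto_mult tendsto_const LIMSEQ_realpow_zero) auto
  then have "\<forall>\<^sub>F n in sequentially. \<rho> ^ n * diameter K < e"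
    using e by (intro order_tendstoD(2)) auto
  then obtain n where n: "\<And>k. n \<le> k \<Longrightarrow> \<rho> ^ k * diameter K < e"
    unfolding eventually_sequentially by blast
  show ?thesis
  proof (rule that)
    fix w x y assume w: "w \<in> finite_words m" "n \<le> length w"
      and "x \<in> cube S K w" "y \<in> cube S K w"
    then obtain x' y' where xy: "x' \<in> K" "y' \<in> K" "x = word_map S w x'" "y = word_map S w y'"
      by (auto simp: cube_def)
    have "dist x y \<le> \<rho> ^ length w * dist x' y'" using word[OF w(1)] xy by simp
    also have "\<dots> \<le> \<rho> ^ length w * diameter K"
      using \<rho>(1) xy diameter_bounded_bound[OF bK] by (intro mult_left_mono) auto
    also have "\<dots> < e" by (rule n[OF w(2)])
    finally show "dist x y < e" .
  qed
qed

text \<open>Choosing preimages in \<open>K\<close> again and again gives a point of \<open>K\<close> an address. The cubes along the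
  address shrink to that point, so that the description in the coding map has a unique solution.\<close>

lemma coding_map_surj:
  assumes x: "x \<in> K"
  obtains \<omega> where "\<omega> \<in> infinite_words m" "coding_map S K \<omega> = x"
proof -
  have "\<forall>y\<in>K. \<exists>i z. i \<in> {1..m} \<and> z \<in> K \<and> y = S i z" using self_similar_invariant by blast
  then obtain I Z where IZ: "\<And>y. y \<in> K \<Longrightarrow> I y \<in> {1..m}" "\<And>y. y \<in> K \<Longrightarrow> Z y \<in> K"
      "\<And>y. y \<in> K \<Longrightarrow> S (I y) (Z y) = y"
    by metis
  define orb where "orb n = (Z ^^ n) x" for n
  define \<omega> where "\<omega> n = I (orb n)" for n
  have orb: "orb n \<in> K" for n unfolding orb_def using x IZ(2) by (induction n) auto
  have \<omega>: "\<omega> n \<in> {1..m}" for n using IZ(1) orb by (simp add: \<omega>_def)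
  have x_eq: "x = word_map S (map \<omega> [0..<n]) (orb n)" for n
  proof (induction n)
    case (Suc n)
    have "S (\<omega> n) (orb (Suc n)) = orb n" using IZ(3)[OF orb[of n]] by (simp add: \<omega>_def orb_def)
    then show ?case using Suc by (simp add: word_map_append)
  qed (simp add: orb_def)
  have in_A: "map \<omega> [0..<n] \<in> finite_words m" for n using \<omega> by (auto simp: finite_words_def)
  have in_cube: "x \<in> cube S K (map \<omega> [0..<n])" for n
    using x_eq[of n] orb[of n] unfolding cube_def by blast
  have sing: "{x} = (\<Inter>n\<in>{1..}. cube S K (map \<omega> [0..<n]))"
  proof (intro equalityI subsetI)
    fix y assume y: "y \<in> (\<Inter>n\<in>{1..}. cube S K (map \<omega> [0..<n]))"
    have "dist x y < e" if e: "0 < e" for e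
    proof -
      obtain n where n: "\<And>w x y. w \<in> finite_words m \<Longrightarrow> n \<le> length w \<Longrightarrow>
          x \<in> cube S K w \<Longrightarrow> y \<in> cube S K w \<Longrightarrow> dist x y < e"
        using small_cubes[OF e] by blast
      have "y \<in> cube S K (map \<omega> [0..<Suc n])" by (rule INT_D[OF y]) simp
      then show ?thesis using n[OF in_A _ in_cube, of "Suc n" y] by simp
    qed
    then have "dist x y \<le> 0" by (meson linorder_not_le order_less_irrefl)
    then show "y \<in> {x}" by simp
  qed (use in_cube in auto)
  have "coding_map S K \<omega> = x"
    unfolding coding_map_def sing[symmetric] by (rule the_equality) auto
  moreover have "\<omega> \<in> infinite_words m" using \<omega> by (auto simp: infinite_words_def)
  ultimately show ?thesis using that by blast
qed

text \<open>A critical sequence is determined by its first letter and its shift, and the shifts form a finite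
  set. So there are finitely many critical sequences, and they code all points of the overlap.\<close>

lemma finite_overlap_set:
  assumes "post_critically_finite m S K"
  shows "finite (overlap_set m S K)"
proof -
  let ?C = "critical_set m S K"
  have "shift ` ?C \<subseteq> (\<Union>n\<in>{1..}. (shift ^^ n) ` ?C)"
    by (rule order_trans[OF _ UN_upper[of 1]]) auto
  then have fin: "finite (shift ` ?C)"
    using assms finite_subset unfolding post_critically_finite_def by blast
  have "inj_on (\<lambda>\<omega>. (\<omega> 0, shift \<omega>)) ?C"
  proof (rule inj_onI)
    fix \<omega> \<omega>' :: "nat \<Rightarrow> nat" assume eq: "(\<omega> 0, shift \<omega>) = (\<omega>' 0, shift \<omega>')"
    have "\<omega> n = \<omega>' n" for n
      using eq by (cases n) (auto simp: shift_def dest: fun_cong)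
    then show "\<omega> = \<omega>'" by blast
  qed
  moreover have "(\<lambda>\<omega>. (\<omega> 0, shift \<omega>)) ` ?C \<subseteq> {1..m} \<times> shift ` ?C"
    by (auto simp: critical_set_def infinite_words_def)
  ultimately have finC: "finite ?C"
    using fin by (meson finite_SigmaI finite_atLeastAtMost finite_imageD finite_subset)
  have "overlap_set m S K \<subseteq> coding_map S K ` ?C"
  proof
    fix x assume x: "x \<in> overlap_set m S K"
    then have "x \<in> K" using self_similar_invariant by (auto simp: overlap_set_def)
    then obtain \<omega> where "\<omega> \<in> infinite_words m" "coding_map S K \<omega> = x" by (rule coding_map_surj)
    then show "x \<in> coding_map S K ` ?C" using x by (force simp: critical_set_def)
  qed
  then show ?thesis using finC finite_surj by blast
qed

lemma inj_word_map: "w \<in> finite_words m \<Longrightarrow> inj (word_map S w)"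
proof (induction w)
  case (Cons i w)
  then have i: "i \<in> {1..m}" and w: "inj (word_map S w)" by (auto simp: finite_words_def)
  have "inj (S i)" using sim i contracting_similarity_bij bij_is_inj by blast
  then show ?case unfolding word_map_Cons using w by (rule inj_compose)
qed simp

text \<open>Strip the common prefix of the two words: what remains starts with different letters and names
  cubes that meet inside the overlap set, and the map of the common prefix is injective.\<close>

lemma finite_Int_parallel_cubes:
  assumes pcf: "post_critically_finite m S K"
    and v: "v \<in> finite_words m" and w: "w \<in> finite_words m" and vw: "v \<parallel> w"
  shows "finite (cube S K v \<inter> cube S K w)"
proof -
  obtain u i v' j w' where d: "i \<noteq> j" "v = u @ i # v'" "w = u @ j # w'"
    using parallel_decomp[OF vw] by blast
  have u: "u \<in> finite_words m" and ij: "i \<in> {1..m}" "j \<in> {1..m}"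
    and iv: "i # v' \<in> finite_words m" and jw: "j # w' \<in> finite_words m"
    using v w by (auto simp: d finite_words_def)
  have "cube S K (i # v') \<subseteq> S i ` K" "cube S K (j # w') \<subseteq> S j ` K"
    using cube_mono[OF iv, of "[i]"] cube_mono[OF jw, of "[j]"] by (auto simp: cube_def)
  then have "cube S K (i # v') \<inter> cube S K (j # w') \<subseteq> overlap_set m S K"
    using ij d(1) unfolding overlap_set_def by (intro subsetI UN_I[of i] UN_I[of j]) auto
  moreover have "cube S K v \<inter> cube S K w = word_map S u ` (cube S K (i # v') \<inter> cube S K (j # w'))"
    unfolding d(2,3) cube_append by (rule image_Int[OF inj_word_map[OF u], symmetric])
  ultimately show ?thesis
    using finite_overlap_set[OF pcf] by (metis finite_imageI finite_subset)
qed

text \<open>Long words name cubes of small diameter, which lie in a small ball around \<open>x\<close>; the measures of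
  these balls tend to the measure of the point \<open>x\<close>, which is zero.\<close>

lemma cube_of_small_measure:
  assumes nfix: "\<not> (\<exists>x. \<forall>i\<in>{1..m}. S i x = x)"
    and p: "probability_vector m p"
    and \<mu>: "self_similar_measure m S p \<mu>"
    and x: "x \<in> K" and e: "0 < e"
  shows "\<exists>w\<in>finite_words m. x \<in> cube S K w \<and> measure \<mu> (cube S K w) < e"
proof -
  interpret prob_space \<mu> using \<mu> by (simp add: self_similar_measure_def)
  have sets: "sets \<mu> = sets borel" using \<mu> by (simp add: self_similar_measure_def)
  let ?B = "\<lambda>n. cball x (inverse (real (Suc n)))"
  have B: "?B n \<in> sets \<mu>" for n unfolding sets by (intro borel_closed closed_cball)
  have "(\<Inter>n. ?B n) = {x}"
  proof (intro equalityI subsetI)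
    fix y assume y: "y \<in> (\<Inter>n. ?B n)"
    have "dist x y \<le> 0"
    proof (rule ccontr)
      assume "\<not> dist x y \<le> 0"
      then obtain n where "inverse (real (Suc n)) < dist x y"
        using reals_Archimedean[of "dist x y"] by auto
      moreover have "dist x y \<le> inverse (real (Suc n))" using y by (auto simp: mem_cball)
      ultimately show False by simp
    qed
    then show "y \<in> {x}" by simp
  qed auto
  moreover have "(\<lambda>n. measure \<mu> (?B n)) \<longlonglongrightarrow> measure \<mu> (\<Inter>n. ?B n)"
  proof (rule finite_Lim_measure_decseq)
    show "range ?B \<subseteq> sets \<mu>" using B by blast
    show "decseq ?B"
      by (intro decseq_SucI subset_cball le_imp_inverse_le) simp_all
  qed
  ultimately have "(\<lambda>n. measure \<mu> (?B n)) \<longlonglongrightarrow> 0"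
    using self_similar_measure_singleton[OF sim nfix p \<mu>] by simp
  then have "\<forall>\<^sub>F n in sequentially. measure \<mu> (?B n) < e"
    using e by (intro order_tendstoD(2)) auto
  then obtain n where n: "measure \<mu> (?B n) < e"
    using eventually_sequentially by auto
  obtain k where k: "\<And>w x y. w \<in> finite_words m \<Longrightarrow> k \<le> length w \<Longrightarrow>
      x \<in> cube S K w \<Longrightarrow> y \<in> cube S K w \<Longrightarrow> dist x y < inverse (real (Suc n))"
    using small_cubes[of "inverse (real (Suc n))"] by (metis inverse_positive_iff_positive of_nat_0_less_iff zero_less_Suc)
  obtain w where w: "w \<in> words m k" "x \<in> cube S K w" using in_cube_of_length[OF x] by blast
  then have A: "w \<in> finite_words m" "k \<le> length w" by (auto simp: words_def finite_words_def)
  have "cube S K w \<subseteq> ?B n"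
  proof
    fix y assume "y \<in> cube S K w"
    then show "y \<in> ?B n" using k[OF A w(2), of y] by simp
  qed
  then have "measure \<mu> (cube S K w) \<le> measure \<mu> (?B n)"
    by (intro finite_measure_mono B)
  then show ?thesis using n A w(2) by (intro bexI[of _ w]) auto
qed

end

section \<open>The weak-type estimate\<close>

text \<open>Words are countable, so a cover by a set of words is a cover by a family indexed by natural
  numbers; conversely, choosing a word for each cube of a family can only merge repeated cubes.\<close>

lemma hausdorff_content_eq_word_content:
  "hausdorff_content (basic_cubes m S K) \<mu> s \<alpha> E =
     word_content (finite_words m) (cube S K) (\<lambda>w. measure \<mu> (cube S K w) powr (\<alpha> / s)) E"
  (is "?L = ?R")
proof (rule antisym)
  let ?c = "\<lambda>I. ennreal (measure \<mu> I powr (\<alpha> / s))"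
  have bc: "basic_cubes m S K = cube S K ` finite_words m"
    by (auto simp: basic_cubes_def words_def finite_words_def)
  show "?L \<le> ?R"
    unfolding word_content_def
  proof (rule INF_greatest)
    fix V assume "V \<in> {V. V \<subseteq> finite_words m \<and> E \<subseteq> (\<Union>v\<in>V. cube S K v)}"
    then have V: "V \<subseteq> finite_words m" "E \<subseteq> (\<Union>v\<in>V. cube S K v)" by auto
    let ?J = "to_nat ` V" and ?I = "\<lambda>n. cube S K (from_nat n)"
    have "?L \<le> (\<Sum>\<^sub>\<infinity>j\<in>?J. ?c (?I j))"
      unfolding hausdorff_content_def
      by (rule INF_lower2[of "(?J, ?I)"]) (use V bc in auto)
    also have "\<dots> = (\<Sum>\<^sub>\<infinity>v\<in>V. ?c (cube S K v))"
      by (subst infsum_reindex) (auto simp: inj_on_def o_def)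
    finally show "?L \<le> (\<Sum>\<^sub>\<infinity>v\<in>V. ?c (cube S K v))" .
  qed
  show "?R \<le> ?L"
    unfolding hausdorff_content_def
  proof (rule INF_greatest, clarify)
    fix J :: "nat set" and I
    assume J: "\<forall>j\<in>J. I j \<in> basic_cubes m S K" "E \<subseteq> (\<Union>j\<in>J. I j)"
    then have "\<forall>j\<in>J. \<exists>w. w \<in> finite_words m \<and> I j = cube S K w" using bc by auto
    then obtain w where w: "\<And>j. j \<in> J \<Longrightarrow> w j \<in> finite_words m"
        "\<And>j. j \<in> J \<Longrightarrow> I j = cube S K (w j)"
      by metis
    have "?R \<le> (\<Sum>\<^sub>\<infinity>v\<in>w ` J. ?c (cube S K v))"
      using w J(2) by (intro word_content_le) auto
    also have "\<dots> \<le> (\<Sum>\<^sub>\<infinity>j\<in>J. ?c (cube S K (w j)))"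
      by (rule infsum_ennreal_image_le)
    also have "\<dots> = (\<Sum>\<^sub>\<infinity>j\<in>J. ?c (I j))"
      using w(2) by (intro infsum_cong) simp
    finally show "?R \<le> (\<Sum>\<^sub>\<infinity>j\<in>J. ?c (I j))" .
  qed
qed

lemma dyadic_maximal_gtD:
  assumes "ennreal t < dyadic_maximal m S K \<mu> f x"
  obtains w where "w \<in> finite_words m" "x \<in> cube S K w"
    "ennreal t * emeasure \<mu> (cube S K w) < (\<integral>\<^sup>+y\<in>cube S K w. ennreal \<bar>f y\<bar> \<partial>completion \<mu>)"
proof -
  obtain w where w: "\<exists>n\<ge>1. w \<in> words m n" "x \<in> cube S K w"
    and gt: "ennreal t <
      (\<integral>\<^sup>+y\<in>cube S K w. ennreal \<bar>f y\<bar> \<partial>completion \<mu>) / emeasure \<mu> (cube S K w)"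
      (is "_ < ?n / ?d")
    using assms unfolding dyadic_maximal_def less_SUP_iff by auto
  have "ennreal t * ?d < ?n"
  proof (rule ccontr)
    assume "\<not> ?thesis"
    then have le: "?n \<le> ennreal t * ?d" by (simp add: not_less)
    \<comment> \<open>On a null cube the quotient is \<open>0 / 0 = 0\<close>.\<close>
    have "?n / ?d \<le> ennreal t"
    proof (cases "?d = 0")
      case True
      then have "?n = 0" using le by simp
      then show ?thesis by simp
    next
      case False
      then show ?thesis
        using le by (intro divide_le_posI_ennreal) (auto simp: zero_less_iff_neq_zero mult.commute)
    qed
    then show False using gt by simp
  qed
  moreover have "w \<in> finite_words m" using w(1) by (auto simp: finite_words_def words_def)
  ultimately show ?thesis using that w(2) by blast
qed

theorem theorem1p2:
  fixes S :: "nat \<Rightarrow> 'a::euclidean_space \<Rightarrow> 'a"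
    and K :: "'a set" and \<mu> :: "'a measure" and f :: "'a \<Rightarrow> real"
    and m :: nat and p :: "nat \<Rightarrow> real" and s \<alpha> t :: real
  assumes "\<forall>i\<in>{1..m}. contracting_similarity (S i)"
    and "\<not> (\<exists>x. \<forall>i\<in>{1..m}. S i x = x)"
    and "self_similar_set m S K"
    and "probability_vector m p"
    and "self_similar_measure m S p \<mu>"
    and "hausdorff_dim K = ennreal s"
    and "post_critically_finite m S K"
    and "0 < \<alpha>" and "\<alpha> \<le> s"
    and "f \<in> choquet_Lp \<mu> (hausdorff_content (basic_cubes m S K) \<mu> s \<alpha>) K (\<alpha> / s)"
    and "0 < t"
  shows "hausdorff_content (basic_cubes m S K) \<mu> s \<alpha>
           {x\<in>K. dyadic_maximal m S K \<mu> f x > ennreal t}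
         \<le> ennreal (4 * (s / \<alpha>) powr (\<alpha> / s) * t powr (- (\<alpha> / s))) *
           choquet_integral (hausdorff_content (basic_cubes m S K) \<mu> s \<alpha>) K
             (\<lambda>x. \<bar>f x\<bar> powr (\<alpha> / s))"
proof -
  note sim = assms(1) and ssK = assms(3)
  interpret prob_space \<mu> using assms(5) by (simp add: self_similar_measure_def)
  have sets: "sets \<mu> = sets borel" using assms(5) by (simp add: self_similar_measure_def)
  have space: "space \<mu> = UNIV" using sets_eq_imp_space_eq[OF sets] by simp
  define \<beta> where "\<beta> = \<alpha> / s"
  have \<beta>: "0 < \<beta>" "\<beta> \<le> 1" using assms(8,9) by (auto simp: \<beta>_def)
  define A where "A = finite_words m"
  define Q where "Q = cube S K"
  define M where "M = completion \<mu>"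
  define c where "c w = measure M (Q w) powr \<beta>" for w
  have finM: "finite_measure M"
    unfolding M_def by (intro finite_measureI) (simp add: emeasure_eq_measure)
  have Q_borel: "Q w \<in> sets \<mu>" if "w \<in> A" for w
    using compact_cube[OF sim ssK] that by (simp add: A_def Q_def sets borel_compact)
  have Q_sets: "Q w \<in> sets M" if "w \<in> A" for w
    using Q_borel[OF that] by (simp add: M_def)
  have c_eq: "c w = measure \<mu> (Q w) powr \<beta>" if "w \<in> A" for w
    using Q_borel[OF that] by (simp add: c_def M_def)
  let ?H = "word_content A Q c"
  have H_eq: "hausdorff_content (basic_cubes m S K) \<mu> s \<alpha> = ?H"
  proof
    fix E
    show "hausdorff_content (basic_cubes m S K) \<mu> s \<alpha> E = ?H E"
      unfolding hausdorff_content_eq_word_content word_content_def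
        A_def[symmetric] Q_def[symmetric] \<beta>_def[symmetric]
      using c_eq by (intro INF_cong infsum_cong) auto
  qed
  have c0: "0 \<le> c w" for w by (simp add: c_def)
  have A_prefix: "v \<in> A" if "w \<in> A" "prefix v w" for v w
    using that set_mono_prefix by (auto simp: A_def finite_words_def)
  have Q_mono: "Q w \<subseteq> Q v" if "w \<in> A" "prefix v w" for v w
    using cube_mono[OF sim ssK] that by (simp add: A_def Q_def)
  have c_mono: "c w \<le> c v" if "w \<in> A" "prefix v w" for v w
    using that Q_mono A_prefix Q_sets \<beta>
    by (auto simp: c_def intro!: powr_mono2 finite_measure.finite_measure_mono[OF finM])
  have Q_K: "Q w \<subseteq> K" if "w \<in> A" for w
    using cube_subset_K[OF sim ssK] that by (simp add: A_def Q_def)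
  have small: "\<exists>w\<in>A. x \<in> Q w \<and> c w < e" if x: "x \<in> K" and e: "0 < e" for x e
  proof -
    have "0 < e powr (1 / \<beta>)" using e by simp
    then obtain w where w: "w \<in> A" "x \<in> Q w" "measure \<mu> (Q w) < e powr (1 / \<beta>)"
      using cube_of_small_measure[OF sim ssK assms(2,4,5) x] unfolding A_def Q_def by blast
    have "c w < (e powr (1 / \<beta>)) powr \<beta>"
      unfolding c_eq[OF w(1)] using w(3) \<beta> by (intro powr_less_mono2) auto
    also have "\<dots> = e" using \<beta> e by (simp add: powr_powr)
    finally show ?thesis using w by blast
  qed
  have negl: "?H (\<Union>v\<in>{v\<in>A. v \<parallel> k}. Q v \<inter> Q k) = 0" if k: "k \<in> A" for k
  proof (rule word_content_countable)
    have "finite (Q v \<inter> Q k)" if "v \<in> A" "v \<parallel> k" for v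
      using finite_Int_parallel_cubes[OF sim ssK assms(7)] that k by (simp add: A_def Q_def)
    then show "countable (\<Union>v\<in>{v\<in>A. v \<parallel> k}. Q v \<inter> Q k)"
      by (intro countable_UN) (auto intro: countable_finite)
    fix x and e :: real assume "x \<in> (\<Union>v\<in>{v\<in>A. v \<parallel> k}. Q v \<inter> Q k)" "0 < e"
    then show "\<exists>w\<in>A. x \<in> Q w \<and> c w < e" using Q_K[OF k] by (intro small) auto
  qed
  let ?h = "\<lambda>x. \<bar>f x\<bar> powr \<beta>"
  define L where "L u = {x\<in>K. u < ?h x}" for u
  have L_anti: "L u \<subseteq> L v" if "v \<le> u" for u v using that by (auto simp: L_def)
  have HL_meas [measurable]: "(\<lambda>u. ?H (L u)) \<in> borel_measurable borel"
    using L_anti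
    by (intro borel_measurable_antimono_ennreal) (auto simp: antimono_def intro!: word_content_mono)
  have HLQ_meas [measurable]: "(\<lambda>u. ?H (L u \<inter> Q w)) \<in> borel_measurable borel" for w
    using L_anti
    by (intro borel_measurable_antimono_ennreal)
      (fastforce simp: antimono_def intro!: word_content_mono)
  define I where "I = (\<integral>\<^sup>+u\<in>{0<..}. ?H (L u) \<partial>lborel)"
  have I_eq: "choquet_integral ?H K ?h = I"
    by (simp add: choquet_integral_def I_def L_def)
  have f_meas: "f \<in> borel_measurable (restrict_space M K)" and I_fin: "I < top"
    using assms(10) unfolding H_eq choquet_Lp_def \<beta>_def[symmetric] M_def by (auto simp: I_eq)
  define C where "C = (1 / \<beta>) powr \<beta> * t powr (- \<beta>)"
  have C0: "0 \<le> C" by (simp add: C_def)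
  define J where "J w = (\<integral>\<^sup>+u\<in>{0<..}. ?H (L u \<inter> Q w) \<partial>lborel)" for w
  define G where "G = {w\<in>A. ennreal t * emeasure \<mu> (Q w) < (\<integral>\<^sup>+y\<in>Q w. ennreal \<bar>f y\<bar> \<partial>M)}"
  \<comment> \<open>On a cube where the mean of \<open>\<bar>f\<bar>\<close> exceeds \<open>t\<close>, solve \<open>t * measure \<mu> (Q w) < \<integral> \<bar>f\<bar> d\<mu>\<close>
    for the weight, bounding the integral by the Choquet integral over the cube.\<close>
  have good: "ennreal (c w) \<le> ennreal C * J w" if w: "w \<in> G" for w
  proof -
    have wA: "w \<in> A" using w by (simp add: G_def)
    have "J w \<le> I"
      unfolding J_def I_def by (intro nn_integral_mono mult_right_mono word_content_mono) auto
    then have "J w < top" using I_fin by (rule le_less_trans)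
    then obtain i where i: "0 \<le> i" "J w = ennreal i" by (cases "J w") auto
    let ?g = "\<lambda>y. \<bar>f y\<bar> * indicator (Q w) y"
    have level: "{x\<in>space M. u < ?g x powr \<beta>} = L u \<inter> Q w" if "0 < u" for u
      using that Q_K[OF wA] by (auto simp: M_def space L_def indicator_def split: if_splits)
    have K_sets: "K \<in> sets M"
      using ssK by (simp add: M_def self_similar_set_def sets borel_compact)
    have "(\<lambda>x. indicator K x *\<^sub>R f x) \<in> borel_measurable M"
      using f_meas K_sets by (subst (asm) borel_measurable_restrict_space_iff) auto
    then have "(\<lambda>x. \<bar>indicator K x *\<^sub>R f x\<bar> * indicator (Q w) x) \<in> borel_measurable M"
      using Q_sets[OF wA] by measurable
    also have "(\<lambda>x. \<bar>indicator K x *\<^sub>R f x\<bar> * indicator (Q w) x) = ?g"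
      using Q_K[OF wA] by (auto simp: fun_eq_iff indicator_def)
    finally have g_meas: "?g \<in> borel_measurable M" .
    have "(\<integral>\<^sup>+y. ennreal (?g y) \<partial>M) \<le> ennreal (1 / \<beta> * i powr (1 / \<beta>))"
    proof (rule nn_integral_le_content_integral_powr[OF finM \<beta> g_meas, of ?H])
      show "0 \<le> ?g x" for x by simp
      show "?H E \<le> ?H F" if "E \<subseteq> F" for E F using that by (rule word_content_mono)
      show "ennreal (measure M {x\<in>space M. u < ?g x powr \<beta>} powr \<beta>)
          \<le> ?H {x\<in>space M. u < ?g x powr \<beta>}" for u
        using measure_powr_le_word_content[OF finM \<beta>, of A Q] Q_sets unfolding c_def by blast
      have "(\<integral>\<^sup>+u\<in>{0<..}. ?H {x\<in>space M. u < ?g x powr \<beta>} \<partial>lborel) = J w"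
      proof (unfold J_def, rule nn_integral_cong)
        fix u :: real
        show "?H {x\<in>space M. u < ?g x powr \<beta>} * indicator {0<..} u =
            ?H (L u \<inter> Q w) * indicator {0<..} u"
        proof (cases "0 < u")
          case True
          show ?thesis unfolding level[OF True] ..
        qed simp
      qed
      then show "(\<integral>\<^sup>+u\<in>{0<..}. ?H {x\<in>space M. u < ?g x powr \<beta>} \<partial>lborel) = ennreal i"
        using i(2) by simp
    qed (rule i(1))
    also have "(\<integral>\<^sup>+y. ennreal (?g y) \<partial>M) = (\<integral>\<^sup>+y\<in>Q w. ennreal \<bar>f y\<bar> \<partial>M)"
      by (intro nn_integral_cong) (simp add: indicator_def)
    finally have "ennreal t * emeasure \<mu> (Q w) \<le> ennreal (1 / \<beta> * i powr (1 / \<beta>))"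
      using w by (auto simp: G_def)
    then have "ennreal (t * measure \<mu> (Q w)) \<le> ennreal (1 / \<beta> * i powr (1 / \<beta>))"
      using assms(11) by (simp add: emeasure_eq_measure ennreal_mult)
    then have "t * measure \<mu> (Q w) \<le> 1 / \<beta> * i powr (1 / \<beta>)"
      using \<beta> by (subst (asm) ennreal_le_iff) auto
    then have "(t * measure \<mu> (Q w)) powr \<beta> \<le> (1 / \<beta> * i powr (1 / \<beta>)) powr \<beta>"
      using \<beta> assms(11) by (intro powr_mono2) auto
    also have "\<dots> = (1 / \<beta>) powr \<beta> * (i powr (1 / \<beta>)) powr \<beta>"
      by (rule powr_mult)
    also have "(i powr (1 / \<beta>)) powr \<beta> = i" using \<beta> i(1) by (simp add: powr_powr)
    also have "(t * measure \<mu> (Q w)) powr \<beta> = t powr \<beta> * c w"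
      using assms(11) by (simp add: c_eq[OF wA] powr_mult)
    finally have "t powr (- \<beta>) * (t powr \<beta> * c w) \<le> t powr (- \<beta>) * ((1 / \<beta>) powr \<beta> * i)"
      by (intro mult_left_mono) auto
    also have "t powr (- \<beta>) * (t powr \<beta> * c w) = c w"
      using assms(11) by (simp add: mult.assoc[symmetric] powr_add[symmetric])
    finally have "c w \<le> C * i" by (simp add: C_def mult_ac)
    then have "ennreal (c w) \<le> ennreal (C * i)" by (rule ennreal_leI)
    then show ?thesis using i C0 by (simp add: ennreal_mult)
  qed
  obtain W where W: "W \<subseteq> G" "prefix_free W" "\<And>g. g \<in> G \<Longrightarrow> \<exists>w\<in>W. prefix w g"
    using minimal_words by blast
  have WA: "W \<subseteq> A" using W(1) by (auto simp: G_def)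
  obtain Z where Z: "Z \<subseteq> W" "packed A c Z" "?H (\<Union>w\<in>W. Q w) \<le> (\<Sum>\<^sub>\<infinity>w\<in>Z. ennreal (c w))"
  proof (rule packed_subfamily[of W A c Q])
    show "W \<subseteq> A" by (rule WA)
    show "v \<in> A" if "w \<in> A" "prefix v w" for v w using that by (rule A_prefix)
    show "0 \<le> c w" for w by (rule c0)
    show "c w \<le> c v" if "w \<in> A" "prefix v w" for v w using that by (rule c_mono)
    show "Q w \<subseteq> Q v" if "w \<in> A" "prefix v w" for v w using that by (rule Q_mono)
  qed (rule that)
  have "{x\<in>K. dyadic_maximal m S K \<mu> f x > ennreal t} \<subseteq> (\<Union>w\<in>W. Q w)"
  proof clarify
    fix x assume x: "x \<in> K" "ennreal t < dyadic_maximal m S K \<mu> f x"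
    from x(2) obtain w where w: "w \<in> A" "x \<in> Q w" "w \<in> G"
      unfolding G_def A_def Q_def M_def by (rule dyadic_maximal_gtD) blast
    then obtain v where "v \<in> W" "prefix v w" using W(3) by blast
    then show "x \<in> (\<Union>w\<in>W. Q w)" using Q_mono[OF w(1)] w(2) by blast
  qed
  then have "?H {x\<in>K. dyadic_maximal m S K \<mu> f x > ennreal t} \<le> ?H (\<Union>w\<in>W. Q w)"
    by (rule word_content_mono)
  also note Z(3)
  also have "(\<Sum>\<^sub>\<infinity>w\<in>Z. ennreal (c w)) \<le> ennreal C * (3 * I)"
  proof (rule infsum_ennreal_le)
    fix F assume F: "finite F" "F \<subseteq> Z"
    have "(\<Sum>w\<in>F. ennreal (c w)) \<le> (\<Sum>w\<in>F. ennreal C * J w)"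
      using F Z(1) W(1) by (intro sum_mono good) auto
    also have "\<dots> = ennreal C * (\<Sum>w\<in>F. J w)" by (rule sum_distrib_left[symmetric])
    also have "(\<Sum>w\<in>F. J w) = (\<integral>\<^sup>+u. (\<Sum>w\<in>F. ?H (L u \<inter> Q w) * indicator {0<..} u) \<partial>lborel)"
      unfolding J_def by (rule nn_integral_sum[symmetric]) measurable
    also have "\<dots> \<le> (\<integral>\<^sup>+u. 3 * (?H (L u) * indicator {0<..} u) \<partial>lborel)"
    proof (rule nn_integral_mono)
      fix u
      have "prefix_free Z" using W(2) Z(1) by (auto simp: prefix_free_def)
      then have "(\<Sum>w\<in>F. ?H (L u \<inter> Q w)) \<le> 3 * ?H (L u)"
        using Z(1) WA by (intro sum_word_content_Int_le[OF _ Z(2) _ c0 negl F]) auto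
      then show "(\<Sum>w\<in>F. ?H (L u \<inter> Q w) * indicator {0<..} u) \<le> 3 * (?H (L u) * indicator {0<..} u)"
        by (simp add: indicator_def)
    qed
    also have "\<dots> = 3 * I" unfolding I_def by (rule nn_integral_cmult) measurable
    finally show "(\<Sum>w\<in>F. ennreal (c w)) \<le> ennreal C * (3 * I)"
      by (simp add: mult_left_mono)
  qed
  also have "ennreal C * (3 * I) \<le> ennreal C * (4 * I)"
    by (intro mult_left_mono mult_right_mono) auto
  also have "\<dots> = ennreal (4 * C) * I"
    using C0 by (simp add: ennreal_mult mult_ac)
  also have "4 * C = 4 * (s / \<alpha>) powr (\<alpha> / s) * t powr (- (\<alpha> / s))"
    by (simp add: C_def \<beta>_def)
  finally show ?thesis unfolding H_eq \<beta>_def[symmetric] I_eq .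
qed

end
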